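(* Let $t\mapsto\rho(t)$ be a positive function satisfying $$\lim_{t\to\infty}\frac{\rho(t)}{\phi_d(t)}=0,\qquad \lim_{t\to\infty}\frac{(\log t)^{1/d}\rho(t)}{\phi_d(t)}=\infty .$$ Let $\mathrm{Wrap}(t,\rho)$ be the event that $\mathbb{T}^d\setminus W_\rho[0,t]$ has a connected component $C$ that, when considered as a Riemannian manifold with its intrinsic metric, is not the isometric image $x+E$ (with $x\in\mathbb{T}^d$) of some bounded subset $E$ of $\mathbb{R}^d$. Then $$\lim_{t\to\infty}\frac{\log\mathbb{P}\big(\mathrm{Wrap}(t,\rho(t))\big)}{\log t}=-\infty.$$
   Context: Fix an integer $d\ge 3$. $\mathbb{T}^d=\mathbb{R}^d/\mathbb{Z}^d$ is the flat unit torus with induced distance $d(\cdot,\cdot)$, viewed as a Riemannian manifold so that the projection $\mathbb{R}^d\to\mathbb{T}^d$ is a local isometry; $\mathbb{R}^d$ acts on it by translation, and $x+E=\{x+y:y\in E\}$ for $x\in\mathbb{T}^d$, $E\subset\mathbb{R}^d$. $W=(W(t))_{t\ge0}$ is Brownian motion on $\mathbb{T}^d$, i.e. $W(t)=x_0+\tilde W(t)$ with $\tilde W$ a standard Brownian motion on $\mathbb{R}^d$ started at $0$; $\mathbb{P}$ is its law, with arbitrary starting point $x_0\in\mathbb{T}^d$. $B(x,r)$ is the closed ball of radius $r$ around $x$, and $W_r[0,t]=\bigcup_{s\in[0,t]}B(W(s),r)$ is the Wiener sausage. Put $$\kappa_d=\frac{2\pi^{d/2}}{\Gamma(d/2-1)},\qquad\phi_d(t)=\Big(\frac{d}{(d-2)\kappa_d}\frac{\log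 t}{t}\Big)^{1/(d-2)}\ (t>1).$$ Convention: $\log 0=-\infty$. *)

theory Defs
  imports "HOL-Probability.Probability"
begin

definition integer_lattice :: "(real ^ 'n::finite) set" where
  "integer_lattice = {z. \<forall>i. z $ i \<in> \<int>}"

lemma integer_lattice_0 [simp]: "0 \<in> integer_lattice"
  by (simp add: integer_lattice_def)

lemma integer_lattice_minus: "z \<in> integer_lattice \<Longrightarrow> - z \<in> integer_lattice"
  by (simp add: integer_lattice_def)

lemma integer_lattice_add:
  "z \<in> integer_lattice \<Longrightarrow> w \<in> integer_lattice \<Longrightarrow> z + w \<in> integer_lattice"
  by (simp add: integer_lattice_def)

lemma integer_lattice_diff:
  "z \<in> integer_lattice \<Longrightarrow> w \<in> integer_lattice \<Longrightarrow> z - w \<in> integer_lattice"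
  by (simp add: integer_lattice_def)

lemma integer_lattice_norm_less_1:
  fixes z :: "real ^ 'n::finite"
  assumes "z \<in> integer_lattice" "norm z < 1"
  shows "z = 0"
proof (rule vec_eq_iff[THEN iffD2], rule allI)
  fix i
  have "\<bar>z $ i\<bar> < 1"
    using component_le_norm_cart[of z i] assms(2) by linarith
  moreover have "z $ i \<in> \<int>"
    using assms(1) by (simp add: integer_lattice_def)
  ultimately show "z $ i = (0 :: real ^ 'n) $ i"
    by (auto elim!: Ints_cases)
qed

quotient_type (overloaded) 'n torus = "real ^ 'n::finite" / "\<lambda>x y. x - y \<in> integer_lattice"
  morphisms rep_torus torus_proj
proof (rule equivpI)
  show "reflp (\<lambda>x y :: real ^ 'n. x - y \<in> integer_lattice)"
    by (simp add: reflp_def)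
  show "symp (\<lambda>x y :: real ^ 'n. x - y \<in> integer_lattice)"
    by (rule sympI) (metis integer_lattice_minus minus_diff_eq)
  show "transp (\<lambda>x y :: real ^ 'n. x - y \<in> integer_lattice)"
  proof (rule transpI)
    fix x y z :: "real ^ 'n"
    assume "x - y \<in> integer_lattice" "y - z \<in> integer_lattice"
    from integer_lattice_add[OF this] show "x - z \<in> integer_lattice" by simp
  qed
qed

lemma torus_proj_eq_iff: "torus_proj x = torus_proj y \<longleftrightarrow> x - y \<in> integer_lattice"
  by (rule torus.abs_eq_iff)

lemma torus_proj_surj: "\<exists>x. torus_proj x = p"
  by (metis Quotient3_abs_rep Quotient3_torus)

lift_definition torus_shift :: "'n::finite torus \<Rightarrow> real ^ 'n \<Rightarrow> 'n torus" is "\<lambda>x y. x + y"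
  by simp

instantiation torus :: (finite) metric_space
begin

definition dist_torus :: "'a torus \<Rightarrow> 'a torus \<Rightarrow> real" where
  "dist_torus p q = Inf {dist x y | x y. torus_proj x = p \<and> torus_proj y = q}"

definition uniformity_torus :: "('a torus \<times> 'a torus) filter" where
  "uniformity_torus = (INF e\<in>{0<..}. principal {(x, y). dist x y < e})"

definition open_torus :: "'a torus set \<Rightarrow> bool" where
  "open_torus U \<longleftrightarrow> (\<forall>x\<in>U. eventually (\<lambda>(x', y). x' = x \<longrightarrow> y \<in> U) uniformity)"

instance
proof
  show "uniformity = (INF e\<in>{0<..}. principal {(x, y :: 'a torus). dist x y < e})"
    by (rule uniformity_torus_def)
  show "open U \<longleftrightarrow> (\<forall>x\<in>U. eventually (\<lambda>(x', y). x' = x \<longrightarrow> y \<in> U) uniformity)"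
    for U :: "'a torus set"
    by (rule open_torus_def)
  let ?D = "\<lambda>p q :: 'a torus. {dist x y | x y. torus_proj x = p \<and> torus_proj y = q}"
  have bdd: "bdd_below (?D p q)" for p q
    by (rule bdd_belowI[of _ 0]) auto
  have ne: "?D p q \<noteq> {}" for p q
    using torus_proj_surj[of p] torus_proj_surj[of q] by blast
  have near: "\<exists>x y. torus_proj x = p \<and> torus_proj y = q \<and> dist x y < e"
    if "dist p q < e" for p q :: "'a torus" and e
    using that cInf_lessD[OF ne[of p q], of e] unfolding dist_torus_def by blast
  have low: "dist (torus_proj x) (torus_proj y) \<le> dist x y" for x y :: "real ^ 'a"
    unfolding dist_torus_def by (rule cInf_lower[OF _ bdd]) blast
  have nonneg: "0 \<le> dist p q" for p q :: "'a torus"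
    unfolding dist_torus_def by (rule cInf_greatest[OF ne]) auto
  show "dist p q = 0 \<longleftrightarrow> p = q" for p q :: "'a torus"
  proof
    assume "p = q"
    obtain x where "torus_proj x = p"
      using torus_proj_surj by blast
    with \<open>p = q\<close> low[of x x] nonneg[of p q] show "dist p q = 0" by simp
  next
    assume d0: "dist p q = 0"
    obtain x y where xy: "torus_proj x = p" "torus_proj y = q" "dist x y < 1 / 2"
      using near[of p q "1 / 2"] d0 by auto
    show "p = q"
    proof (rule ccontr)
      assume "p \<noteq> q"
      with xy have "dist x y > 0" by auto
      then obtain x' y' where xy': "torus_proj x' = p" "torus_proj y' = q" "dist x' y' < dist x y"
        using near[of p q "dist x y"] d0 by auto
      define z where "z = (x' - x) - (y' - y)"
      have "x' - x \<in> integer_lattice" "y' - y \<in> integer_lattice"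
        using xy xy' by (metis torus_proj_eq_iff)+
      then have "z \<in> integer_lattice"
        unfolding z_def by (rule integer_lattice_diff)
      moreover have "norm z < 1"
      proof -
        have "z = (x' - y') - (x - y)"
          by (simp add: z_def)
        then have "norm z \<le> norm (x' - y') + norm (x - y)"
          by (simp only: norm_triangle_ineq4)
        with xy(3) xy'(3) show ?thesis by (simp add: dist_norm)
      qed
      ultimately have "z = 0"
        by (rule integer_lattice_norm_less_1)
      then have "x' - y' = x - y"
        by (simp add: z_def algebra_simps)
      with xy'(3) show False by (simp add: dist_norm)
    qed
  qed
  show "dist p q \<le> dist p r + dist q r" for p q r :: "'a torus"
  proof (rule field_le_epsilon)
    fix e :: real
    assume e: "0 < e"
    obtain x z where xz: "torus_proj x = p" "torus_proj z = r" "dist x z < dist p r + e / 2"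
      using near[of p r "dist p r + e / 2"] e by auto
    obtain y w where yw: "torus_proj y = q" "torus_proj w = r" "dist y w < dist q r + e / 2"
      using near[of q r "dist q r + e / 2"] e by auto
    have "z - w \<in> integer_lattice"
      using xz(2) yw(2) by (metis torus_proj_eq_iff)
    then have q: "torus_proj (y + (z - w)) = q"
      unfolding yw(1)[symmetric] torus_proj_eq_iff by simp
    have "dist p q \<le> dist x (y + (z - w))"
      using low[of x "y + (z - w)"] xz(1) q by simp
    also have "\<dots> = norm ((x - z) - (y - w))"
      by (simp add: dist_norm algebra_simps)
    also have "\<dots> \<le> dist x z + dist y w"
      by (simp only: dist_norm norm_triangle_ineq4)
    finally show "dist p q \<le> dist p r + dist q r + e"
      using xz(3) yw(3) by linarith
  qed
qed

end

locale standard_brownian_motion = prob_space M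
  for M :: "'a measure" and B :: "real \<Rightarrow> 'a \<Rightarrow> real ^ 'n::finite" +
  assumes measurable_at: "0 \<le> t \<Longrightarrow> B t \<in> borel_measurable M"
    and start_0: "\<omega> \<in> space M \<Longrightarrow> B 0 \<omega> = 0"
    and continuous_paths: "\<omega> \<in> space M \<Longrightarrow> continuous_on {0..} (\<lambda>t. B t \<omega>)"
    and indep_increments: "0 \<le> \<tau> 0 \<Longrightarrow> incseq \<tau> \<Longrightarrow>
          indep_vars (\<lambda>_. borel) (\<lambda>i \<omega>. B (\<tau> (Suc i)) \<omega> - B (\<tau> i) \<omega>) {..<m::nat}"
    and gaussian_increments: "0 \<le> s \<Longrightarrow> s < t \<Longrightarrow>
          distributed M lborel (\<lambda>\<omega>. B t \<omega> - B s \<omega>)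
            (\<lambda>x. ennreal (\<Prod>i\<in>UNIV. normal_density 0 (sqrt (t - s)) (x $ i)))"

text \<open>A sample path of Brownian motion on the torus from \<open>x\<^sub>0\<close> is
  \<open>\<lambda>s. torus_shift x\<^sub>0 (B s \<omega>)\<close>.\<close>

definition wiener_sausage :: "(real \<Rightarrow> 'a::metric_space) \<Rightarrow> real \<Rightarrow> real \<Rightarrow> 'a set" where
  "wiener_sausage w r t = (\<Union>s\<in>{0..t}. cball (w s) r)"

definition curve_length :: "(real \<Rightarrow> 'a::metric_space) \<Rightarrow> ennreal" where
  "curve_length g =
     (SUP (m, p) \<in> {(m :: nat, p :: nat \<Rightarrow> real). mono_on {..m} p \<and> p ` {..m} \<subseteq> {0..1}}.
        \<Sum>i<m. ennreal (dist (g (p i)) (g (p (Suc i)))))"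

text \<open>The intrinsic (length) metric of a subset. On an open subset of the torus or of Euclidean
  space this is the Riemannian distance; it is infinite between points that no rectifiable
  curve inside the set joins.\<close>

definition intrinsic_dist :: "'a::metric_space set \<Rightarrow> 'a \<Rightarrow> 'a \<Rightarrow> ennreal" where
  "intrinsic_dist S u v =
     Inf {curve_length g | g. path g \<and> path_image g \<subseteq> S \<and> pathstart g = u \<and> pathfinish g = v}"

text \<open>Both \<open>C\<close> and \<open>E\<close> carry their own intrinsic metrics, not the restrictions of the ambient
  ones; in particular a set that winds around the torus is not the isometric image of a
  fundamental domain.\<close>

definition isometric_image_of_bounded :: "'n::finite torus set \<Rightarrow> bool" where
  "isometric_image_of_bounded C \<longleftrightarrow>
     (\<exists>x E. bounded E \<and> C = torus_shift x ` E \<and>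
        (\<forall>u\<in>E. \<forall>v\<in>E. intrinsic_dist C (torus_shift x u) (torus_shift x v) = intrinsic_dist E u v))"

definition wraps :: "(real \<Rightarrow> 'n::finite torus) \<Rightarrow> real \<Rightarrow> real \<Rightarrow> bool" where
  "wraps w t r \<longleftrightarrow>
     (\<exists>C \<in> components (- wiener_sausage w r t). \<not> isometric_image_of_bounded C)"

definition kappa :: "nat \<Rightarrow> real" where
  "kappa d = 2 * pi powr (real d / 2) / Gamma (real d / 2 - 1)"

definition phi :: "nat \<Rightarrow> real \<Rightarrow> real" where
  "phi d t = (real d / ((real d - 2) * kappa d) * (ln t / t)) powr (1 / (real d - 2))"

text \<open>The library has \<open>ln 0 = 0\<close> for reals; here the logarithm of \<open>0\<close> is \<open>-\<infinity>\<close>.\<close>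

definition ereal_log :: "real \<Rightarrow> ereal" where
  "ereal_log p = (if p = 0 then -\<infinity> else ereal (ln p))"

end

theory Submission
  imports Defs "HOL-Real_Asymp.Real_Asymp"
begin

text \<open>
  A component that wraps around the torus cannot be small: if it lies within distance \<open>1/8\<close> of one of
  its points, then the projection from Euclidean space restricts to an isometry onto it
  (\<open>isometric_image_of_bounded_if_small\<close>). Being connected and macroscopic, a wrapping component
  contains, for any \<open>n\<close> and any spacing \<open>R\<close> with \<open>n R\<close> small, points \<open>x 0, \<dots>, x (n - 1)\<close> with
  \<open>x k\<close> at distance \<open>k R\<close> from \<open>x 0\<close> (\<open>wraps_separated_points\<close>), and the path stays at distance
  more than \<open>\<rho>\<close> from all of them up to time \<open>t\<close>. The proof shows that this is unlikely, already for
  \<open>n\<close> of order \<open>ln t\<close> and \<open>R\<close> of order \<open>n\<^sup>2 \<rho>\<close>.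

  After rounding to a grid whose mesh \<open>r\<close> is a small multiple of \<open>\<rho>\<close>, the path avoids \<open>n\<close> cubes of size
  \<open>r\<close> at mutual distance of order \<open>n\<^sup>2 r\<close>. Such sparse targets hardly interact. By the second moment
  method, Brownian motion started anywhere hits one of them during a time interval of length \<open>2\<close> with
  probability at least a constant times \<open>n\<close> times \<open>r\<close> to the power \<open>d - 2\<close> (\<open>block_hit_prob\<close>), where
  \<open>d \<ge> 3\<close> guarantees that a cube, once hit, is revisited a bounded number of times on average. Independence
  of the increments over successive intervals (\<open>block_avoidance\<close>) bounds the probability of avoidance
  up to time \<open>t\<close> by the exponential of minus a constant times \<open>t n \<rho> ^ (d - 2)\<close>. The lower bound on
  \<open>\<rho>\<close> says that \<open>t \<rho> ^ (d - 2)\<close> is much larger than \<open>ln t powr (2 / d)\<close>.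

  It remains to count the rounded configurations: there are at most polynomially many in \<open>t\<close> positions
  for the first point and polynomially many in \<open>n\<close> positions for each of the others relative to it, which
  gives \<open>exp (O (ln t + n ln n))\<close>. For \<open>n\<close> of order \<open>ln t\<close> this is \<open>exp (O (ln t ln (ln t)))\<close>, and
  the union bound \<open>wraps_prob_le\<close> beats it, and any power of \<open>t\<close>, because \<open>ln t powr (2 / d)\<close> beats
  \<open>ln (ln t)\<close>.
\<close>

section \<open>Components of small diameter do not wrap\<close>

lemma dist_torus_proj_le: "dist (torus_proj x) (torus_proj y) \<le> dist x y"
  unfolding dist_torus_def by (rule cInf_lower) (auto intro: bdd_belowI[of _ 0])

text \<open>Lifting one point with another: the distance in the torus is almost attained by some pair of
  lifts, and a lattice translation moves the first of them to any prescribed lift.\<close>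

lemma torus_lift_near:
  assumes "dist (torus_proj x) q < e"
  obtains y where "torus_proj y = q" "dist x y < e"
proof -
  have "{dist u v |u v. torus_proj u = torus_proj x \<and> torus_proj v = q} \<noteq> {}"
    using torus_proj_surj[of q] by blast
  from cInf_lessD[OF this] obtain u v where
    uv: "torus_proj u = torus_proj x" "torus_proj v = q" "dist u v < e"
    using assms unfolding dist_torus_def by blast
  have "torus_proj (v + (x - u)) = q"
    using uv by (metis add_diff_cancel_left' integer_lattice_minus minus_diff_eq torus_proj_eq_iff)
  moreover have "dist x (v + (x - u)) = dist u v"
    by (simp add: dist_norm algebra_simps)
  ultimately show thesis using that uv(3) by metis
qed

text \<open>A strictly closer pair of lifts would differ from the given pair by a lattice vector of norm
  less than one.\<close>

lemma dist_torus_proj_eq: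
  assumes "dist x y \<le> 1 / 2"
  shows "dist (torus_proj x) (torus_proj y) = dist x y"
proof (rule antisym[OF dist_torus_proj_le], rule ccontr)
  assume "\<not> dist x y \<le> dist (torus_proj x) (torus_proj y)"
  then obtain y' where y': "torus_proj y' = torus_proj y" "dist x y' < dist x y"
    using torus_lift_near[of x "torus_proj y" "dist x y"] by (metis not_le)
  have "y' - y \<in> integer_lattice" using y'(1) by (simp add: torus_proj_eq_iff)
  moreover have "norm (y' - y) < 1"
    using dist_triangle2[of y' y x] y'(2) assms by (simp add: dist_norm norm_minus_commute)
  ultimately have "y' = y" using integer_lattice_norm_less_1 by force
  with y'(2) show False by simp
qed

lemma torus_shift_proj: "torus_shift (torus_proj a) v = torus_proj (a + v)"
  by (simp add: torus_shift.abs_eq)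

lemma curve_length_cong:
  assumes "\<And>s s'. s \<in> {0..1} \<Longrightarrow> s' \<in> {0..1} \<Longrightarrow> dist (g s) (g s') = dist (h s) (h s')"
  shows "curve_length g = curve_length h"
  unfolding curve_length_def
proof (rule SUP_cong[OF refl], clarify)
  fix m :: nat and p :: "nat \<Rightarrow> real"
  assume p: "p ` {..m} \<subseteq> {0..1}"
  show "(\<Sum>i<m. ennreal (dist (g (p i)) (g (p (Suc i))))) = (\<Sum>i<m. ennreal (dist (h (p i)) (h (p (Suc i)))))"
  proof (rule sum.cong[OF refl])
    fix i assume "i \<in> {..<m}"
    then have "p i \<in> {0..1}" "p (Suc i) \<in> {0..1}" using p by (auto simp: image_subset_iff)
    then show "ennreal (dist (g (p i)) (g (p (Suc i)))) = ennreal (dist (h (p i)) (h (p (Suc i))))"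
      by (simp only: assms)
  qed
qed

text \<open>Composition with \<open>f\<close> and with its inverse puts the curves in \<open>E\<close> and the curves in the image
  into bijection and preserves lengths, so both infima are taken over the same set.\<close>

lemma intrinsic_dist_isometric_image:
  fixes f :: "'b::metric_space \<Rightarrow> 'c::metric_space"
  assumes iso: "\<And>u v. u \<in> E \<Longrightarrow> v \<in> E \<Longrightarrow> dist (f u) (f v) = dist u v"
    and uv: "u \<in> E" "v \<in> E"
  shows "intrinsic_dist (f ` E) (f u) (f v) = intrinsic_dist E u v"
proof -
  have inj: "inj_on f E"
    by (rule inj_onI) (metis iso dist_eq_0_iff)
  have contf: "continuous_on E f"
    by (intro continuous_on_iff[THEN iffD2]) (use iso in metis)
  define k where "k = the_inv_into E f"
  have k: "k (f x) = x" if "x \<in> E" for x using that inj by (simp add: k_def the_inv_into_f_f)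
  have contk: "continuous_on (f ` E) k"
    by (rule continuous_on_iff[THEN iffD2]) (auto simp: k iso)
  have "{curve_length g | g. path g \<and> path_image g \<subseteq> f ` E \<and> pathstart g = f u \<and> pathfinish g = f v}
      = {curve_length g | g. path g \<and> path_image g \<subseteq> E \<and> pathstart g = u \<and> pathfinish g = v}"
    (is "?L = ?R")
  proof
    show "?R \<subseteq> ?L"
    proof clarify
      fix g assume g: "path g" "path_image g \<subseteq> E" "u = pathstart g" "v = pathfinish g"
      have "curve_length g = curve_length (f \<circ> g)"
        by (rule curve_length_cong) (use g(2) iso in \<open>auto simp: path_image_def image_subset_iff\<close>)
      moreover have "path (f \<circ> g)"
        using g contf by (intro path_continuous_image) (auto intro: continuous_on_subset)
      ultimately show "\<exists>h. curve_length g = curve_length h \<and> path h \<and> path_image h \<subseteq> f ` E \<and>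
          pathstart h = f (pathstart g) \<and> pathfinish h = f (pathfinish g)"
        using g by (intro exI[of _ "f \<circ> g"]) (auto simp: path_image_compose pathstart_compose pathfinish_compose)
    qed
    show "?L \<subseteq> ?R"
    proof clarify
      fix g assume g: "path g" "path_image g \<subseteq> f ` E" "pathstart g = f u" "pathfinish g = f v"
      have "curve_length g = curve_length (k \<circ> g)"
      proof (rule curve_length_cong)
        fix s s' :: real assume "s \<in> {0..1}" "s' \<in> {0..1}"
        then have "g s \<in> f ` E" "g s' \<in> f ` E" using g(2) by (auto simp: path_image_def)
        then show "dist (g s) (g s') = dist ((k \<circ> g) s) ((k \<circ> g) s')"
          using k iso by auto
      qed
      moreover have "path (k \<circ> g)"
        using g contk by (intro path_continuous_image) (auto intro: continuous_on_subset)
      moreover have "path_image (k \<circ> g) \<subseteq> E"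
        using g(2) k by (auto simp: path_image_compose)
      ultimately show "\<exists>h. curve_length g = curve_length h \<and> path h \<and> path_image h \<subseteq> E \<and>
          pathstart h = u \<and> pathfinish h = v"
        using g k uv
        by (intro exI[of _ "k \<circ> g"]) (simp add: pathstart_compose pathfinish_compose)
    qed
  qed
  then show ?thesis by (simp add: intrinsic_dist_def)
qed

text \<open>Wrapping needs size. The radius \<open>1/8\<close> is chosen so that two points of the lifted set are at
  distance at most \<open>1/4\<close>, well inside the range in which the projection preserves distances.\<close>

lemma isometric_image_of_bounded_if_small:
  assumes "\<And>q. q \<in> C \<Longrightarrow> dist p q < 1 / 8"
  shows "isometric_image_of_bounded C"
proof -
  obtain a where a: "torus_proj a = p" using torus_proj_surj by blast
  define E where "E = {v. norm v < 1 / 8 \<and> torus_proj (a + v) \<in> C}"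
  have "bounded E" unfolding E_def bounded_iff by (intro exI[of _ "1/8"]) auto
  have C: "C = torus_shift p ` E"
  proof
    show "torus_shift p ` E \<subseteq> C" by (auto simp: E_def a[symmetric] torus_shift_proj)
    show "C \<subseteq> torus_shift p ` E"
    proof
      fix q assume q: "q \<in> C"
      then obtain y where y: "torus_proj y = q" "dist a y < 1 / 8"
        using torus_lift_near[of a q "1/8"] assms a by metis
      then have "y - a \<in> E" "torus_shift p (y - a) = q"
        using q by (auto simp: E_def a[symmetric] torus_shift_proj dist_norm norm_minus_commute)
      then show "q \<in> torus_shift p ` E" by blast
    qed
  qed
  have "dist (torus_shift p u) (torus_shift p v) = dist u v" if "u \<in> E" "v \<in> E" for u v
  proof -
    have "dist (a + u) (a + v) \<le> norm u + norm v"
      by (simp add: dist_norm norm_triangle_ineq4)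
    then have "dist (a + u) (a + v) \<le> 1 / 2" using that by (simp add: E_def)
    then show ?thesis unfolding a[symmetric] torus_shift_proj by (simp add: dist_torus_proj_eq)
  qed
  from intrinsic_dist_isometric_image[of E "torus_shift p", OF this]
  show ?thesis unfolding isometric_image_of_bounded_def
    using \<open>bounded E\<close> C by blast
qed

lemma connected_points_at_distances:
  fixes C :: "'b::metric_space set"
  assumes "connected C" "p \<in> C" "q \<in> C" "\<And>k::nat. k < n \<Longrightarrow> R k \<in> {0..dist p q}"
  obtains x where "\<And>k. k < n \<Longrightarrow> x k \<in> C \<and> dist p (x k) = R k"
proof -
  have "connected (dist p ` C)"
    using assms(1) by (intro connected_continuous_image continuous_intros)
  moreover have "0 \<in> dist p ` C" "dist p q \<in> dist p ` C"
    using assms(2,3) by (metis dist_self imageI)+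
  ultimately have "{0..dist p q} \<subseteq> dist p ` C"
    by (rule connected_contains_Icc)
  with assms(4) have "\<forall>k<n. \<exists>x. x \<in> C \<and> dist p x = R k" by (force simp: image_iff)
  then show thesis using that by metis
qed

text \<open>A wrapping component is connected and has macroscopic diameter, so the distance to a fixed
  point of it takes all values up to \<open>1/8\<close>. Points at distances \<open>k R\<close> from the base point are at
  mutual distance at least \<open>R\<close> by the triangle inequality.\<close>

lemma wraps_separated_points:
  fixes w :: "real \<Rightarrow> 'n::finite torus"
  assumes w: "wraps w t r" and R: "0 \<le> R" "real n * R \<le> 1 / 8"
  obtains x where "\<And>k s. k < n \<Longrightarrow> s \<in> {0..t} \<Longrightarrow> dist (w s) (x k) > r"
    "\<And>k. k < n \<Longrightarrow> dist (x 0) (x k) = real k * R"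
proof -
  obtain C where C: "C \<in> components (- wiener_sausage w r t)" "\<not> isometric_image_of_bounded C"
    using w by (auto simp: wraps_def)
  then obtain p where p: "p \<in> C" using in_components_nonempty by blast
  obtain q where q: "q \<in> C" "dist p q \<ge> 1 / 8"
    using isometric_image_of_bounded_if_small C(2) by (metis not_le)
  have kR: "real k * R \<in> {0..dist p q}" if "k < n" for k
    using that R q(2) mult_right_mono[of "real k" "real n" R] by auto
  obtain x where x: "\<And>k. k < n \<Longrightarrow> x k \<in> C \<and> dist p (x k) = real k * R"
    using connected_points_at_distances[OF in_components_connected[OF C(1)] p q(1), of n "\<lambda>k. real k * R"] kR
    by blast
  have out: "dist (w s) (x k) > r" if "k < n" "s \<in> {0..t}" for k s
  proof -
    have "x k \<notin> wiener_sausage w r t"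
      using x[OF that(1)] in_components_subset[OF C(1)] by auto
    with that(2) show ?thesis by (auto simp: wiener_sausage_def not_le)
  qed
  have "dist (x 0) (x k) = real k * R" if "k < n" for k
    using x[of 0] x[OF that] that by auto
  with out that show thesis by blast
qed

section \<open>Gaussian increments in cubes\<close>

text \<open>Cubes rather than balls, since then volumes, rounding to a grid and products of one-dimensional
  densities are all explicit.\<close>

definition cube :: "real ^ 'n::finite \<Rightarrow> real \<Rightarrow> (real ^ 'n) set" where
  "cube c r = {x. \<forall>i. \<bar>x $ i - c $ i\<bar> \<le> r}"

lemma cube_eq_cbox: "cube c r = cbox (\<chi> i. c $ i - r) (\<chi> i. c $ i + r)"
  by (auto simp: cube_def mem_box_cart abs_le_iff algebra_simps)

lemma sets_cube [measurable]: "cube c r \<in> sets borel"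
  by (simp add: cube_eq_cbox)

lemma emeasure_cube:
  fixes c :: "real ^ 'n::finite"
  assumes "0 \<le> r"
  shows "emeasure lborel (cube c r) = ennreal ((2 * r) ^ CARD('n))"
proof -
  have "cbox (\<chi> i. c $ i - r) (\<chi> i. c $ i + r) \<noteq> ({} :: (real ^ 'n) set)"
    using assms by (simp add: interval_ne_empty_cart)
  from content_cbox_cart[OF this]
  have "measure lborel (cube c r) = (2 * r) ^ CARD('n)"
    by (simp add: cube_eq_cbox)
  moreover have "emeasure lborel (cube c r) \<noteq> \<infinity>"
    by (metis cube_eq_cbox emeasure_lborel_cbox_finite less_irrefl)
  ultimately show ?thesis by (metis emeasure_eq_ennreal_measure infinity_ennreal_def)
qed

lemma dist_le_of_mem_cube:
  fixes x c :: "real ^ 'n::finite"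
  assumes "x \<in> cube c r"
  shows "dist x c \<le> real CARD('n) * r"
proof -
  have "dist x c \<le> (\<Sum>i\<in>UNIV. \<bar>(x - c) $ i\<bar>)"
    unfolding dist_norm by (rule norm_le_l1_cart)
  also have "\<dots> \<le> (\<Sum>i\<in>(UNIV :: 'n set). r)"
    using assms by (intro sum_mono) (simp add: cube_def)
  finally show ?thesis by simp
qed

lemma prod_normal_density:
  fixes x :: "real ^ 'n::finite"
  assumes "0 < s"
  shows "(\<Prod>i\<in>UNIV. normal_density 0 (sqrt s) (x $ i))
    = (1 / sqrt (2 * pi * s)) ^ CARD('n) * exp (- (norm x)\<^sup>2 / (2 * s))"
proof -
  have "(norm x)\<^sup>2 = (\<Sum>i\<in>UNIV. (x $ i)\<^sup>2)"
    by (simp add: norm_vec_def L2_set_def real_sqrt_pow2 sum_nonneg)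
  then have "exp (- (norm x)\<^sup>2 / (2 * s)) = (\<Prod>i\<in>UNIV. exp (- (x $ i)\<^sup>2 / (2 * s)))"
    by (simp add: exp_sum[symmetric] sum_divide_distrib[symmetric] sum_negf)
  with assms show ?thesis
    by (simp add: normal_density_def prod.distrib power_divide prod_dividef)
qed

text \<open>Gaussian decay enters in this polynomial form: multiplied with \<open>m powr (- 3 / 2)\<close>
  from the heat kernel it leaves a summable power of \<open>m\<close>.\<close>

lemma exp_minus_le_powr_quarter:
  fixes u :: real assumes "0 < u"
  shows "exp (- u) \<le> u powr (- 1 / 4)"
proof -
  have "u \<le> exp u" using exp_ge_add_one_self[of u] by linarith
  have "exp (-u) \<le> exp (- u / 4)" using assms by simp
  also have "\<dots> = exp u powr (- 1 / 4)" by (simp add: powr_def)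
  also have "\<dots> \<le> u powr (- 1 / 4)"
    using assms \<open>u \<le> exp u\<close> by (intro powr_mono2') auto
  finally show ?thesis .
qed

text \<open>The second moment method for the number \<open>Z\<close> of events that occur. The rank is meant as the time
  of an event: by symmetry it suffices to bound, for each event, its joint probabilities with the
  events that are not earlier.\<close>

lemma (in prob_space) second_moment_bound:
  fixes A :: "'i \<Rightarrow> 'a set" and rank :: "'i \<Rightarrow> nat"
  assumes fin: "finite I" and A: "\<And>a. a \<in> I \<Longrightarrow> A a \<in> events" and K: "0 < K"
    and later: "\<And>a. a \<in> I \<Longrightarrow> (\<Sum>b\<in>{b\<in>I. rank a \<le> rank b}. prob (A a \<inter> A b)) \<le> K * prob (A a)"
  shows "(\<Sum>a\<in>I. prob (A a)) \<le> 2 * K * prob (\<Union>a\<in>I. A a)"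
proof -
  define E where "E = (\<Sum>a\<in>I. prob (A a))"
  define P where "P a b = prob (A a \<inter> A b)" for a b
  define Q where "Q = (\<Sum>a\<in>I. \<Sum>b\<in>I. P a b)"
  have "Q \<le> (\<Sum>a\<in>I. \<Sum>b\<in>I. (if rank a \<le> rank b then P a b else 0) + (if rank b \<le> rank a then P a b else 0))"
    unfolding Q_def by (intro sum_mono) (auto simp: P_def)
  also have "\<dots> = (\<Sum>a\<in>I. \<Sum>b\<in>I. if rank a \<le> rank b then P a b else 0)
      + (\<Sum>b\<in>I. \<Sum>a\<in>I. if rank b \<le> rank a then P a b else 0)"
    unfolding sum.distrib by (subst (2) sum.swap) simp
  also have "(\<Sum>b\<in>I. \<Sum>a\<in>I. if rank b \<le> rank a then P a b else 0)
      = (\<Sum>a\<in>I. \<Sum>b\<in>I. if rank a \<le> rank b then P a b else 0)"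
    by (intro sum.cong refl if_cong) (simp add: P_def Int_commute)
  also have "(\<Sum>a\<in>I. \<Sum>b\<in>I. if rank a \<le> rank b then P a b else 0)
      + (\<Sum>a\<in>I. \<Sum>b\<in>I. if rank a \<le> rank b then P a b else 0)
      = 2 * (\<Sum>a\<in>I. \<Sum>b\<in>I. if rank a \<le> rank b then P a b else 0)"
    by simp
  also have "\<dots> \<le> 2 * (\<Sum>a\<in>I. K * prob (A a))"
    using later fin by (intro mult_left_mono sum_mono) (auto simp: sum.inter_filter[symmetric] P_def)
  finally have Q: "Q \<le> 2 * K * E" by (simp add: E_def sum_distrib_left mult_ac)
  \<comment> \<open>Instead of Cauchy-Schwarz: \<open>1 - (1 - l Z)\<^sup>2\<close> is at most \<open>1\<close> and vanishes where \<open>Z = 0\<close>,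
     so it is dominated by the indicator of the union; this \<open>l\<close> gives the best bound.\<close>
  define l where "l = 1 / (2 * K)"
  define Z where "Z \<omega> = (\<Sum>a\<in>I. indicator (A a) \<omega> :: real)" for \<omega>
  have intA: "integrable M (indicator (A a) :: _ \<Rightarrow> real)" if "a \<in> I" for a
    using A[OF that] by (simp add: less_top[symmetric])
  have Zsq: "(Z \<omega>)\<^sup>2 = (\<Sum>a\<in>I. \<Sum>b\<in>I. indicator (A a \<inter> A b) \<omega>)" for \<omega>
    by (simp add: Z_def power2_eq_square sum_product indicator_inter_arith)
  have intAB: "integrable M (indicator (A a \<inter> A b) :: _ \<Rightarrow> real)" if "a \<in> I" "b \<in> I" for a b
    using A[OF that(1)] A[OF that(2)] by (simp add: less_top[symmetric])
  have iZ: "integrable M Z" "expectation Z = E"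
    unfolding Z_def E_def using intA A by (auto simp: Bochner_Integration.integral_sum)
  have iZ2: "integrable M (\<lambda>\<omega>. (Z \<omega>)\<^sup>2)" "expectation (\<lambda>\<omega>. (Z \<omega>)\<^sup>2) = Q"
    unfolding Zsq Q_def P_def using intAB A by (auto simp: Bochner_Integration.integral_sum)
  have U: "(\<Union>a\<in>I. A a) \<in> events" using fin A by auto
  have "expectation (\<lambda>\<omega>. 2 * l * Z \<omega> - l\<^sup>2 * (Z \<omega>)\<^sup>2) \<le> expectation (indicator (\<Union>a\<in>I. A a))"
  proof (rule integral_mono)
    show "integrable M (\<lambda>\<omega>. 2 * l * Z \<omega> - l\<^sup>2 * (Z \<omega>)\<^sup>2)" using iZ iZ2 by auto
    show "integrable M (indicator (\<Union>a\<in>I. A a) :: _ \<Rightarrow> real)" using U by (simp add: less_top[symmetric])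
    fix \<omega>
    show "2 * l * Z \<omega> - l\<^sup>2 * (Z \<omega>)\<^sup>2 \<le> indicator (\<Union>a\<in>I. A a) \<omega>"
    proof (cases "\<omega> \<in> (\<Union>a\<in>I. A a)")
      case True
      have "0 \<le> (1 - l * Z \<omega>)\<^sup>2" by simp
      with True show ?thesis by (simp add: power2_eq_square algebra_simps)
    next
      case False
      then have "Z \<omega> = 0" by (auto simp: Z_def indicator_def intro!: sum.neutral)
      then show ?thesis by (simp add: indicator_def)
    qed
  qed
  then have "2 * l * E - l\<^sup>2 * Q \<le> prob (\<Union>a\<in>I. A a)"
    using iZ iZ2 U by simp
  moreover have "l\<^sup>2 * Q \<le> l\<^sup>2 * (2 * K * E)" using Q by (intro mult_left_mono) auto
  moreover have "l\<^sup>2 * (2 * K * E) = l * E" using K by (simp add: l_def power2_eq_square)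
  ultimately have "l * E \<le> prob (\<Union>a\<in>I. A a)" by linarith
  then show ?thesis using K by (simp add: l_def E_def field_simps)
qed

context standard_brownian_motion
begin

lemma measurable_increment [measurable]:
  "0 \<le> s \<Longrightarrow> 0 \<le> t \<Longrightarrow> (\<lambda>\<omega>. B t \<omega> - B s \<omega>) \<in> borel_measurable M"
  by (intro borel_measurable_diff measurable_at)

lemma event_increment_cube:
  assumes "0 \<le> s" "0 \<le> t"
  shows "{\<omega>\<in>space M. B t \<omega> - B s \<omega> \<in> cube c r} \<in> events"
  using measurable_sets[OF measurable_increment[OF assms] sets_cube, of c r]
  by (simp add: vimage_def Int_def conj_commute)

lemma increment_cube_prob_eq:
  assumes "0 \<le> s" "s < t"
  shows "ennreal (prob {\<omega>\<in>space M. B t \<omega> - B s \<omega> \<in> cube c r}) = 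
    (\<integral>\<^sup>+x. ennreal ((1 / sqrt (2 * pi * (t - s))) ^ CARD('n) * exp (- (norm x)\<^sup>2 / (2 * (t - s)))) 
        * indicator (cube c r) x \<partial>lborel)"
proof -
  have "{\<omega>\<in>space M. B t \<omega> - B s \<omega> \<in> cube c r} = (\<lambda>\<omega>. B t \<omega> - B s \<omega>) -` cube c r \<inter> space M" by auto
  with distributed_emeasure[OF gaussian_increments[OF assms], of "cube c r"] assms
  show ?thesis by (simp add: prod_normal_density emeasure_eq_measure)
qed

lemma increment_cube_upper:
  assumes "0 \<le> s" "s < t" "0 \<le> r" "0 \<le> D" "\<And>x. x \<in> cube c r \<Longrightarrow> D \<le> norm x"
  shows "prob {\<omega>\<in>space M. B t \<omega> - B s \<omega> \<in> cube c r}
    \<le> (2 * r / sqrt (2 * pi * (t - s))) ^ CARD('n) * exp (- D\<^sup>2 / (2 * (t - s)))"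
proof -
  let ?K = "(1 / sqrt (2 * pi * (t - s))) ^ CARD('n) * exp (- D\<^sup>2 / (2 * (t - s)))"
  have K: "0 \<le> ?K" using assms by simp
  have "ennreal (prob {\<omega>\<in>space M. B t \<omega> - B s \<omega> \<in> cube c r})
     \<le> (\<integral>\<^sup>+x. ennreal ?K * indicator (cube c r) x \<partial>lborel)"
    unfolding increment_cube_prob_eq[OF assms(1,2)]
  proof (rule nn_integral_mono)
    fix x :: "real ^ 'n"
    have "(norm x)\<^sup>2 \<ge> D\<^sup>2" if "x \<in> cube c r" using assms(4) assms(5)[OF that] by (simp add: power_mono)
    then show "ennreal ((1 / sqrt (2 * pi * (t - s))) ^ CARD('n) * exp (- (norm x)\<^sup>2 / (2 * (t - s)))) * indicator (cube c r) x
         \<le> ennreal ?K * indicator (cube c r) x"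
      using assms(2) by (auto simp: indicator_def divide_le_cancel intro!: ennreal_leI mult_left_mono)
  qed
  also have "\<dots> = ennreal (?K * (2 * r) ^ CARD('n))"
    using assms(3) K by (simp add: nn_integral_cmult_indicator emeasure_cube ennreal_mult)
  finally have "prob {\<omega>\<in>space M. B t \<omega> - B s \<omega> \<in> cube c r} \<le> ?K * (2 * r) ^ CARD('n)"
    using assms(3) K by (subst (asm) ennreal_le_iff) auto
  then show ?thesis by (simp add: power_divide mult_ac)
qed

lemma increment_cube_lower:
  assumes "0 \<le> s" "s < t" "0 \<le> r" "\<And>x. x \<in> cube c r \<Longrightarrow> (norm x)\<^sup>2 \<le> D"
  shows "(2 * r / sqrt (2 * pi * (t - s))) ^ CARD('n) * exp (- D / (2 * (t - s)))
    \<le> prob {\<omega>\<in>space M. B t \<omega> - B s \<omega> \<in> cube c r}"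
proof -
  let ?K = "(1 / sqrt (2 * pi * (t - s))) ^ CARD('n) * exp (- D / (2 * (t - s)))"
  have K: "0 \<le> ?K" using assms by simp
  have "ennreal (?K * (2 * r) ^ CARD('n)) = (\<integral>\<^sup>+x. ennreal ?K * indicator (cube c r) x \<partial>lborel)"
    using assms(3) K by (simp add: nn_integral_cmult_indicator emeasure_cube ennreal_mult)
  also have "\<dots> \<le> ennreal (prob {\<omega>\<in>space M. B t \<omega> - B s \<omega> \<in> cube c r})"
    unfolding increment_cube_prob_eq[OF assms(1,2)]
    using assms(2,4) by (intro nn_integral_mono)
       (auto simp: indicator_def divide_le_cancel intro!: ennreal_leI mult_left_mono)
  finally show ?thesis
    by (subst (asm) ennreal_le_iff) (auto simp: power_divide mult_ac)
qed

lemma indep_increments_two: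
  assumes "0 \<le> s" "s \<le> t" "t \<le> u" "E \<in> sets borel" "F \<in> sets borel"
  shows "prob {\<omega>\<in>space M. B t \<omega> - B s \<omega> \<in> E \<and> B u \<omega> - B t \<omega> \<in> F}
    = prob {\<omega>\<in>space M. B t \<omega> - B s \<omega> \<in> E} * prob {\<omega>\<in>space M. B u \<omega> - B t \<omega> \<in> F}"
proof -
  define \<tau> where "\<tau> i = (if i = 0 then s else if i = Suc 0 then t else u)" for i :: nat
  have inc: "incseq \<tau>" using assms by (intro incseq_SucI) (auto simp: \<tau>_def)
  define A where "A i = (if i = 0 then E else F)" for i :: nat
  have ind: "indep_vars (\<lambda>_. borel) (\<lambda>i \<omega>. B (\<tau> (Suc i)) \<omega> - B (\<tau> i) \<omega>) {..<2::nat}"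
    by (rule indep_increments[OF _ inc]) (use assms in \<open>simp add: \<tau>_def\<close>)
  have "prob (\<Inter>i\<in>{0, Suc 0}. (\<lambda>\<omega>. B (\<tau> (Suc i)) \<omega> - B (\<tau> i) \<omega>) -` A i \<inter> space M)
    = (\<Prod>i\<in>{0, Suc 0}. prob ((\<lambda>\<omega>. B (\<tau> (Suc i)) \<omega> - B (\<tau> i) \<omega>) -` A i \<inter> space M))"
    by (rule indep_varsD[OF ind]) (use assms in \<open>auto simp: A_def\<close>)
  then show ?thesis
    by (simp add: \<tau>_def A_def vimage_def Int_def conj_commute conj_left_commute)
qed

end

context standard_brownian_motion
begin

text \<open>At time distance \<open>m r\<^sup>2\<close> the heat kernel is of order \<open>(m r\<^sup>2)\<close> to the power \<open>- d / 2\<close>, so the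
  powers of \<open>r\<close> cancel against the volume of the cube. Dimension at least three enters here: it makes
  the bound summable in \<open>m\<close>, which is transience at scale \<open>r\<close>.\<close>

lemma increment_cube_diag:
  assumes dim: "3 \<le> CARD('n)" and s: "0 \<le> s" "s < t" and r: "0 < r" and m: "1 \<le> m"
    and lower: "m * r\<^sup>2 / 2 \<le> t - s"
    and D: "0 \<le> D" "\<And>x. x \<in> cube c (2 * r) \<Longrightarrow> D \<le> norm x"
  shows "prob {\<omega>\<in>space M. B t \<omega> - B s \<omega> \<in> cube c (2 * r)}
    \<le> 4 ^ CARD('n) * m powr (- 3 / 2) * exp (- D\<^sup>2 / (2 * (t - s)))"
proof -
  have sm: "1 \<le> sqrt m" using m by simp
  have "m * r\<^sup>2 \<le> 2 * (t - s)" using lower by simp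
  also have "\<dots> \<le> pi * (2 * (t - s))"
    using s pi_ge_two by simp
  finally have "sqrt (m * r\<^sup>2) \<le> sqrt (2 * pi * (t - s))"
    by (simp add: mult_ac)
  then have le: "sqrt m * r \<le> sqrt (2 * pi * (t - s))"
    using r by (simp add: real_sqrt_mult)
  have pos: "0 < sqrt m * r" using sm r by (intro mult_pos_pos) auto
  have "2 * (2 * r) / sqrt (2 * pi * (t - s)) \<le> 2 * (2 * r) / (sqrt m * r)"
    using le pos r s m by (intro divide_left_mono mult_pos_pos) auto
  also have "\<dots> = 4 * (1 / sqrt m)" using r sm by (simp add: field_simps)
  finally have "(2 * (2 * r) / sqrt (2 * pi * (t - s))) ^ CARD('n) \<le> (4 * (1 / sqrt m)) ^ CARD('n)"
    using r s by (intro power_mono) auto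
  also have "\<dots> \<le> 4 ^ CARD('n) * (1 / sqrt m) ^ 3"
    unfolding power_mult_distrib using sm dim
    by (intro mult_left_mono power_decreasing) auto
  also have "(1 / sqrt m) ^ 3 = m powr (- 3 / 2)"
  proof -
    have "1 / sqrt m = m powr (- 1 / 2)"
      using m by (simp add: powr_half_sqrt[symmetric] powr_minus field_simps)
    then show ?thesis using m by (simp add: powr_realpow[symmetric] powr_powr)
  qed
  finally have "(2 * (2 * r) / sqrt (2 * pi * (t - s))) ^ CARD('n) \<le> 4 ^ CARD('n) * m powr (- 3 / 2)" .
  then have "(2 * (2 * r) / sqrt (2 * pi * (t - s))) ^ CARD('n) * exp (- D\<^sup>2 / (2 * (t - s)))
      \<le> 4 ^ CARD('n) * m powr (- 3 / 2) * exp (- D\<^sup>2 / (2 * (t - s)))"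
    by (rule mult_right_mono) simp
  moreover have "0 \<le> 2 * r" using r by simp
  ultimately show ?thesis
    using increment_cube_upper[OF s _ D] by (meson order_trans)
qed

lemma increment_cube_near:
  assumes dim: "3 \<le> CARD('n)" and s: "0 \<le> s" "s < t" and r: "0 < r" and m: "1 \<le> m"
    and lower: "m * r\<^sup>2 / 2 \<le> t - s"
  shows "prob {\<omega>\<in>space M. B t \<omega> - B s \<omega> \<in> cube c (2 * r)} \<le> 4 ^ CARD('n) * m powr (- 5 / 4)"
proof -
  have "m powr (- 3 / 2) \<le> m powr (- 5 / 4)" using m by (intro powr_mono) auto
  then have "4 ^ CARD('n) * m powr (- 3 / 2) \<le> 4 ^ CARD('n) * m powr (- 5 / 4)"
    by (rule mult_left_mono) simp
  moreover have "prob {\<omega>\<in>space M. B t \<omega> - B s \<omega> \<in> cube c (2 * r)} \<le> 4 ^ CARD('n) * m powr (- 3 / 2)"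
    using increment_cube_diag[OF assms, of 0 c] by simp
  ultimately show ?thesis by linarith
qed

text \<open>The gain of a factor \<open>n\<close> over the diagonal bound compensates for the \<open>n\<close> different targets in the
  second moment; it is the reason for spacing the targets by about \<open>n\<^sup>2 r\<close>.\<close>

lemma increment_cube_far:
  assumes dim: "3 \<le> CARD('n)" and s: "0 \<le> s" "s < t" and r: "0 < r" and m: "1 \<le> m"
    and lower: "m * r\<^sup>2 / 2 \<le> t - s" and upper: "t - s \<le> m * r\<^sup>2" and n: "0 < n"
    and far: "\<And>x. x \<in> cube c (2 * r) \<Longrightarrow> 2 * n\<^sup>2 * r \<le> norm x"
  shows "prob {\<omega>\<in>space M. B t \<omega> - B s \<omega> \<in> cube c (2 * r)} \<le> 4 ^ CARD('n) * m powr (- 5 / 4) / n"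
proof -
  let ?D = "2 * n\<^sup>2 * r"
  have D: "0 < ?D" using n r by simp
  have u: "n ^ 4 / m \<le> ?D\<^sup>2 / (2 * (t - s))"
  proof -
    have "n ^ 4 / m = ?D\<^sup>2 / (4 * (m * r\<^sup>2))"
      using r by (simp add: field_simps power2_eq_square power4_eq_xxxx)
    also have "\<dots> \<le> ?D\<^sup>2 / (2 * (t - s))"
      using upper s r m D by (intro divide_left_mono) (auto intro!: mult_pos_pos)
    finally show ?thesis .
  qed
  have "exp (- ?D\<^sup>2 / (2 * (t - s))) \<le> exp (- (n ^ 4 / m))" using u by simp
  also have "\<dots> \<le> (n ^ 4 / m) powr (- 1 / 4)"
    by (rule exp_minus_le_powr_quarter, rule divide_pos_pos) (use n m in simp_all)
  also have "\<dots> = m powr (1 / 4) / n"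
  proof -
    have "(n ^ 4 / m) powr (- 1 / 4) = (n powr 4) powr (- 1 / 4) / m powr (- 1 / 4)"
      using n m by (simp add: powr_divide)
    also have "\<dots> = n powr (- 1) / m powr (- 1 / 4)" by (simp add: powr_powr)
    also have "\<dots> = m powr (1 / 4) / n"
      using n m by (simp add: powr_minus field_simps)
    finally show ?thesis .
  qed
  finally have "4 ^ CARD('n) * m powr (- 3 / 2) * exp (- ?D\<^sup>2 / (2 * (t - s)))
     \<le> 4 ^ CARD('n) * m powr (- 3 / 2) * (m powr (1 / 4) / n)"
    by (intro mult_left_mono) auto
  also have "\<dots> = 4 ^ CARD('n) * m powr (- 5 / 4) / n"
    by (simp add: powr_add[symmetric])
  finally have decay: "4 ^ CARD('n) * m powr (- 3 / 2) * exp (- ?D\<^sup>2 / (2 * (t - s)))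
     \<le> 4 ^ CARD('n) * m powr (- 5 / 4) / n" .
  have "prob {\<omega>\<in>space M. B t \<omega> - B s \<omega> \<in> cube c (2 * r)}
    \<le> 4 ^ CARD('n) * m powr (- 3 / 2) * exp (- ?D\<^sup>2 / (2 * (t - s)))"
    by (rule increment_cube_diag[OF dim s r m lower less_imp_le[OF D] far])
  with decay show ?thesis by (rule order_trans[rotated])
qed

text \<open>The walk visits the second cube after the first only if the increment in between falls in the
  cube of twice the size around the difference of the centres, and that increment is independent of
  the first visit.\<close>

lemma joint_cube_prob:
  assumes "0 \<le> s" "s \<le> t" "t \<le> u"
  shows "prob {\<omega>\<in>space M. B t \<omega> - B s \<omega> \<in> cube a r \<and> B u \<omega> - B s \<omega> \<in> cube c r}
    \<le> prob {\<omega>\<in>space M. B t \<omega> - B s \<omega> \<in> cube a r} *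
       prob {\<omega>\<in>space M. B u \<omega> - B t \<omega> \<in> cube (c - a) (2 * r)}"
proof -
  have "B u \<omega> - B t \<omega> \<in> cube (c - a) (2 * r)"
    if "B t \<omega> - B s \<omega> \<in> cube a r" "B u \<omega> - B s \<omega> \<in> cube c r" for \<omega>
    unfolding cube_def
  proof (clarsimp)
    fix i
    have "\<bar>B t \<omega> $ i - B s \<omega> $ i - a $ i\<bar> \<le> r" "\<bar>B u \<omega> $ i - B s \<omega> $ i - c $ i\<bar> \<le> r"
      using that by (auto simp: cube_def)
    then show "\<bar>B u \<omega> $ i - B t \<omega> $ i - (c $ i - a $ i)\<bar> \<le> 2 * r" by linarith
  qed
  then have "prob {\<omega>\<in>space M. B t \<omega> - B s \<omega> \<in> cube a r \<and> B u \<omega> - B s \<omega> \<in> cube c r}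
    \<le> prob {\<omega>\<in>space M. B t \<omega> - B s \<omega> \<in> cube a r \<and> B u \<omega> - B t \<omega> \<in> cube (c - a) (2 * r)}"
    using assms by (intro finite_measure_mono) (auto intro!: sets.sets_Collect_conj event_increment_cube)
  also have "\<dots> = prob {\<omega>\<in>space M. B t \<omega> - B s \<omega> \<in> cube a r} *
       prob {\<omega>\<in>space M. B u \<omega> - B t \<omega> \<in> cube (c - a) (2 * r)}"
    using assms by (intro indep_increments_two) auto
  finally show ?thesis .
qed

end

section \<open>Hitting a sparse family of cubes in one time block\<close>

lemma sum_powr_le_suminf:
  assumes "finite F" "\<And>m. m \<in> F \<Longrightarrow> 1 \<le> m"
  shows "(\<Sum>m\<in>F. real m powr (- 5 / 4)) \<le> (\<Sum>m. real m powr (- 5 / 4))"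
  using assms by (intro sum_le_suminf) (auto simp: summable_real_powr_iff)

text \<open>The numerator comes from the lower bound for the Gaussian density at times in \<open>[1, 2]\<close> and at
  points with coordinates at most \<open>4\<close>; the denominator bounds the ratio of second to first moment.\<close>

definition hit_const :: "nat \<Rightarrow> real" where
  "hit_const d = (1 / sqrt pi) ^ d * exp (- 8 * real d) /
     (2 * (1 + 2 * 4 ^ d * (\<Sum>m. real m powr (- 5 / 4))))"

lemma suminf_powr_nonneg: "0 \<le> (\<Sum>m. real m powr (- 5 / 4))"
  by (intro suminf_nonneg) (auto simp: summable_real_powr_iff)

lemma hit_const_pos: "0 < hit_const d"
  unfolding hit_const_def using suminf_powr_nonneg
  by (intro divide_pos_pos mult_pos_pos) (auto intro!: add_pos_nonneg mult_nonneg_nonneg)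

context standard_brownian_motion
begin

text \<open>Well separated cubes are hit almost as if they were independent targets: the hitting
  probability is of the order of \<open>n\<close> times that of a single cube, which is \<open>r\<close> to the power \<open>d - 2\<close>.
  The Brownian motion is observed only at the times \<open>k / N\<close> in \<open>(1, 2]\<close>, with \<open>1 / N\<close> of order
  \<open>r\<^sup>2\<close>, the time needed to cross a cube; \<open>A\<close> is the family of visits, indexed by time and target.\<close>

lemma block_hit_prob:
  fixes C :: "nat \<Rightarrow> real ^ 'n"
  assumes dim: "3 \<le> CARD('n)" and s0: "0 \<le> s0" and r: "0 < r" "r \<le> 1"
    and N: "N = nat \<lceil>1 / r\<^sup>2\<rceil>"
    and C: "\<And>j i. j < n \<Longrightarrow> \<bar>C j $ i\<bar> \<le> 3"
    and sep: "\<And>i j. i < n \<Longrightarrow> j < n \<Longrightarrow> i \<noteq> j \<Longrightarrow> 4 * real CARD('n) * (real n)\<^sup>2 * r \<le> dist (C i) (C j)"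
  shows "hit_const CARD('n) * real n * r ^ (CARD('n) - 2)
    \<le> prob {\<omega>\<in>space M. \<exists>k\<in>{N<..2*N}. \<exists>j<n. B (s0 + real k / real N) \<omega> - B s0 \<omega> \<in> cube (C j) r}"
proof (cases "n = 0")
  case True then show ?thesis by simp
next
  case False
  then have n1: "1 \<le> real n" by simp
  define d where "d = CARD('n)"
  have N1: "1 / r\<^sup>2 \<le> real N" unfolding N by linarith
  have inv1: "1 \<le> 1 / r\<^sup>2" using r by (simp add: power_le_one)
  have N0: "0 < real N" using N1 inv1 by linarith
  have N2: "real N \<le> 2 * (1 / r\<^sup>2)"
    using inv1 unfolding N by linarith
  have delta: "r\<^sup>2 / 2 \<le> 1 / real N" "1 / real N \<le> r\<^sup>2"
    using N1 N2 N0 r by (auto simp: field_simps)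
  define T where "T k = s0 + real k / real N" for k
  have T: "s0 \<le> T k" "0 \<le> T k" for k using s0 N0 by (auto simp: T_def)
  define I where "I = {N<..2*N} \<times> {..<n}"
  define A where "A a = {\<omega>\<in>space M. B (T (fst a)) \<omega> - B s0 \<omega> \<in> cube (C (snd a)) r}" for a
  have finI: "finite I" by (simp add: I_def)
  have evA: "A a \<in> events" for a
    unfolding A_def using s0 T by (intro event_increment_cube) auto
  define S where "S = (\<Sum>m. real m powr (- 5 / 4))"
  define K where "K = 1 + 2 * 4 ^ d * S"
  have S0: "0 \<le> S" unfolding S_def by (rule suminf_powr_nonneg)
  have K: "0 < K" using S0 by (simp add: K_def add_pos_nonneg)
  have d0: "3 \<le> real d" using dim by (simp add: d_def)
  have n2: "1 \<le> (real n)\<^sup>2" using n1 by (simp add: one_le_power)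
  have far: "2 * (real n)\<^sup>2 * r \<le> norm x"
    if "x \<in> cube (C j - C i) (2 * r)" "i < n" "j < n" "i \<noteq> j" for x i j
  proof -
    have "4 * real d * (real n)\<^sup>2 * r \<le> norm (C j - C i)"
      using sep[OF that(2,3,4)] by (simp add: dist_norm norm_minus_commute d_def)
    also have "\<dots> \<le> norm x + dist x (C j - C i)"
      using norm_triangle_ineq2[of "C j - C i" x] by (simp add: dist_norm norm_minus_commute)
    also have "\<dots> \<le> norm x + 2 * real d * r"
      using dist_le_of_mem_cube[OF that(1)] by (simp add: d_def)
    finally have *: "4 * real d * (real n)\<^sup>2 * r - 2 * real d * r \<le> norm x" by simp
    have "2 * (real n)\<^sup>2 * r + 2 * real d * r \<le> 4 * real d * (real n)\<^sup>2 * r"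
    proof -
      have "1 * (real n)\<^sup>2 \<le> real d * (real n)\<^sup>2" using d0 by (intro mult_right_mono) auto
      moreover have "real d * 1 \<le> real d * (real n)\<^sup>2" using n2 d0 by (intro mult_left_mono) auto
      ultimately have "2 * (real n)\<^sup>2 + 2 * real d \<le> 4 * real d * (real n)\<^sup>2" by linarith
      from mult_right_mono[OF this, of r] r show ?thesis by (simp add: algebra_simps)
    qed
    with * show ?thesis by linarith
  qed
  have later: "(\<Sum>b\<in>{b\<in>I. fst a \<le> fst b}. prob (A a \<inter> A b)) \<le> K * prob (A a)" if a: "a \<in> I" for a
  proof -
    obtain k i where ki: "a = (k, i)" "k \<in> {N<..2*N}" "i < n" using a by (auto simp: I_def)
    \<comment> \<open>Simultaneous visits of different targets are impossible, the cubes being disjoint.\<close>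
    have now: "prob (A (k, i) \<inter> A (k, j)) = 0" if "j < n" "j \<noteq> i" for j
    proof -
      have "A (k, i) \<inter> A (k, j) = {}"
      proof (rule ccontr)
        assume "A (k, i) \<inter> A (k, j) \<noteq> {}"
        then obtain x where x: "x \<in> cube (C i) r" "x \<in> cube (C j) r" by (auto simp: A_def)
        have "0 \<in> cube (C j - C i) (2 * r)"
          unfolding cube_def mem_Collect_eq
        proof
          fix l
          have "\<bar>x $ l - C i $ l\<bar> \<le> r" "\<bar>x $ l - C j $ l\<bar> \<le> r" using x by (auto simp: cube_def)
          then show "\<bar>0 $ l - (C j - C i) $ l\<bar> \<le> 2 * r"
            unfolding zero_index vector_minus_component by linarith
        qed
        from far[OF this ki(3) that(1)] that(2) r n1 show False
          by (simp add: mult_le_0_iff)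
      qed
      then show ?thesis by simp
    qed
    \<comment> \<open>A target is revisited \<open>m\<close> steps later with probability summable in \<open>m\<close>, and each of the
       other targets is visited with \<open>1 / n\<close> times that probability.\<close>
    have joint: "prob (A (k, i) \<inter> A (k + m, j)) \<le> prob (A (k, i)) * (4 ^ d * real m powr (- 5 / 4) * (if j = i then 1 else 1 / real n))"
      if m: "1 \<le> m" and j: "j < n" for m j
    proof -
      have Tm: "T (k + m) - T k = real m * (1 / real N)"
        by (simp add: T_def add_divide_distrib)
      have lt: "T k < T (k + m)" using N0 m by (simp add: T_def divide_strict_right_mono)
      have low: "real m * r\<^sup>2 / 2 \<le> T (k + m) - T k" and up: "T (k + m) - T k \<le> real m * r\<^sup>2"
        unfolding Tm using delta mult_left_mono[OF delta(1), of "real m"] mult_left_mono[OF delta(2), of "real m"] by auto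
      have m': "1 \<le> real m" using m by simp
      have "prob (A (k, i) \<inter> A (k + m, j)) \<le> prob (A (k, i)) * prob {\<omega>\<in>space M. B (T (k + m)) \<omega> - B (T k) \<omega> \<in> cube (C j - C i) (2 * r)}"
        using joint_cube_prob[OF s0 T(1)[of k] less_imp_le[OF lt], of "C i" r "C j"]
        by (simp add: A_def Int_def conj_ac)
      also have "\<dots> \<le> prob (A (k, i)) * (4 ^ d * real m powr (- 5 / 4) * (if j = i then 1 else 1 / real n))"
      proof (rule mult_left_mono[OF _ measure_nonneg], cases "j = i")
        case True
        with increment_cube_near[OF dim T(2) lt r(1) m' low]
        show "prob {\<omega>\<in>space M. B (T (k + m)) \<omega> - B (T k) \<omega> \<in> cube (C j - C i) (2 * r)}
          \<le> 4 ^ d * real m powr (- 5 / 4) * (if j = i then 1 else 1 / real n)"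
          by (simp add: d_def)
      next
        case False
        with increment_cube_far[OF dim T(2) lt r(1) m' low up, of "real n" "C j - C i"] far[OF _ ki(3) j] n1
        show "prob {\<omega>\<in>space M. B (T (k + m)) \<omega> - B (T k) \<omega> \<in> cube (C j - C i) (2 * r)}
          \<le> 4 ^ d * real m powr (- 5 / 4) * (if j = i then 1 else 1 / real n)"
          by (simp add: d_def)
      qed
      finally show ?thesis .
    qed
    have eqI: "{b\<in>I. fst a \<le> fst b} = {k..2*N} \<times> {..<n}" using ki by (auto simp: I_def)
    have split: "{k..2*N} = insert k {k<..2*N}" using ki(2) by auto
    have "(\<Sum>b\<in>{b\<in>I. fst a \<le> fst b}. prob (A a \<inter> A b)) = (\<Sum>l\<in>{k..2*N}. \<Sum>j<n. prob (A (k,i) \<inter> A (l, j)))"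
      unfolding eqI by (simp add: ki(1) sum.cartesian_product split_def)
    also have "\<dots> = (\<Sum>j<n. prob (A (k,i) \<inter> A (k, j))) + (\<Sum>l\<in>{k<..2*N}. \<Sum>j<n. prob (A (k,i) \<inter> A (l, j)))"
      unfolding split by simp
    also have "(\<Sum>j<n. prob (A (k,i) \<inter> A (k, j))) = prob (A (k, i))"
      using now ki(3) by (subst sum.remove[of _ i]) auto
    also have "(\<Sum>l\<in>{k<..2*N}. \<Sum>j<n. prob (A (k,i) \<inter> A (l, j)))
      \<le> (\<Sum>l\<in>{k<..2*N}. \<Sum>j<n. prob (A (k, i)) * (4 ^ d * real (l - k) powr (- 5 / 4) * (if j = i then 1 else 1 / real n)))"
    proof (intro sum_mono)
      fix l j assume "l \<in> {k<..2*N}" "j \<in> {..<n}"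
      then show "prob (A (k,i) \<inter> A (l, j)) \<le> prob (A (k, i)) * (4 ^ d * real (l - k) powr (- 5 / 4) * (if j = i then 1 else 1 / real n))"
        using joint[of "l - k" j] by auto
    qed
    also have "\<dots> = (\<Sum>l\<in>{k<..2*N}. \<Sum>j<n. (prob (A (k, i)) * 4 ^ d) * (real (l - k) powr (- 5 / 4) * (if j = i then 1 else 1 / real n)))"
      by (simp only: mult.assoc)
    also have "\<dots> = (prob (A (k, i)) * 4 ^ d) * ((\<Sum>l\<in>{k<..2*N}. real (l - k) powr (- 5 / 4)) * (\<Sum>j<n. if j = i then 1 else 1 / real n))"
      unfolding sum_product by (simp only: sum_distrib_left)
    also have "\<dots> = prob (A (k, i)) * 4 ^ d * (\<Sum>l\<in>{k<..2*N}. real (l - k) powr (- 5 / 4)) * (\<Sum>j<n. if j = i then 1 else 1 / real n)"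
      by (simp only: mult.assoc)
    also have "\<dots> \<le> prob (A (k, i)) * 4 ^ d * S * 2"
    proof (intro mult_mono)
      have "(\<Sum>l\<in>{k<..2*N}. real (l - k) powr (- 5 / 4)) = (\<Sum>m\<in>(\<lambda>l. l - k) ` {k<..2*N}. real m powr (- 5 / 4))"
        by (subst sum.reindex) (auto simp: inj_on_def)
      also have "\<dots> \<le> S"
        unfolding S_def by (rule sum_powr_le_suminf) auto
      finally show "(\<Sum>l\<in>{k<..2*N}. real (l - k) powr (- 5 / 4)) \<le> S" .
      have "(\<Sum>j<n. if j = i then 1 else 1 / real n) \<le> (\<Sum>j<n. (if j = i then 1 else 0) + 1 / real n)"
        by (intro sum_mono) auto
      also have "\<dots> = 2" using ki(3) n1 by (simp add: sum.distrib)
      finally show "(\<Sum>j<n. if j = i then 1 else 1 / real n) \<le> 2" .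
    qed (auto simp: S0 intro!: sum_nonneg mult_nonneg_nonneg)
    also have "prob (A (k, i)) + prob (A (k, i)) * 4 ^ d * S * 2 = K * prob (A a)"
      by (simp add: K_def ki(1) algebra_simps)
    finally show ?thesis by simp
  qed
  have E1: "(\<Sum>a\<in>I. prob (A a)) \<le> 2 * K * prob (\<Union>a\<in>I. A a)"
    by (rule second_moment_bound[where rank = fst, OF finI evA K later])
  have E2: "real N * real n * ((r / sqrt pi) ^ d * exp (- 8 * real d)) \<le> (\<Sum>a\<in>I. prob (A a))"
  proof -
    have "(r / sqrt pi) ^ d * exp (- 8 * real d) \<le> prob (A a)" if aI: "a \<in> I" for a
    proof -
      obtain k j where kj: "a = (k, j)" "k \<in> {N<..2*N}" "j < n" using aI by (auto simp: I_def)
      have s: "1 < T k - s0" "T k - s0 \<le> 2" using kj(2) N0 by (auto simp: T_def field_simps)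
      have nx: "(norm x)\<^sup>2 \<le> 16 * real d" if x: "x \<in> cube (C j) r" for x
      proof -
        have "(norm x)\<^sup>2 = (\<Sum>i\<in>UNIV. (x $ i)\<^sup>2)"
          by (simp add: norm_vec_def L2_set_def real_sqrt_pow2 sum_nonneg)
        also have "\<dots> \<le> (\<Sum>i\<in>(UNIV::'n set). 4\<^sup>2)"
        proof (rule sum_mono)
          fix i
          have "\<bar>x $ i - C j $ i\<bar> \<le> r" using x by (simp add: cube_def)
          then have "\<bar>x $ i\<bar> \<le> 4" using C[OF kj(3), of i] r(2) by linarith
          then show "(x $ i)\<^sup>2 \<le> 4\<^sup>2" by (metis abs_ge_zero power2_abs power_mono)
        qed
        finally show ?thesis by (simp add: d_def)
      qed
      have lower: "(2 * r / sqrt (2 * pi * (T k - s0))) ^ CARD('n) * exp (- (16 * real d) / (2 * (T k - s0))) \<le> prob (A a)"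
        unfolding A_def kj(1) fst_conv snd_conv
        using s s0 r nx by (intro increment_cube_lower) auto
      have power: "(r / sqrt pi) ^ d \<le> (2 * r / sqrt (2 * pi * (T k - s0))) ^ CARD('n)"
      proof -
        have "sqrt (2 * pi * (T k - s0)) \<le> sqrt (2\<^sup>2 * pi)" using s by simp
        also have "\<dots> = 2 * sqrt pi" by (simp add: real_sqrt_mult)
        finally have "2 * r / (2 * sqrt pi) \<le> 2 * r / sqrt (2 * pi * (T k - s0))"
          using s r by (intro divide_left_mono) auto
        then show ?thesis unfolding d_def using r by (intro power_mono) auto
      qed
      have gauss: "exp (- 8 * real d) \<le> exp (- (16 * real d) / (2 * (T k - s0)))"
      proof -
        have "16 * real d / (2 * (T k - s0)) \<le> 16 * real d / 2"
          using s by (intro divide_left_mono) auto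
        then show ?thesis by simp
      qed
      have "0 \<le> 2 * r / sqrt (2 * pi * (T k - s0))"
        using r(1) s(1) by (intro divide_nonneg_nonneg) auto
      from order_trans[OF mult_mono[OF power gauss zero_le_power[OF this] exp_ge_zero] lower]
      show ?thesis .
    qed
    then have "(\<Sum>a\<in>I. (r / sqrt pi) ^ d * exp (- 8 * real d)) \<le> (\<Sum>a\<in>I. prob (A a))"
      by (rule sum_mono)
    then show ?thesis by (simp add: I_def mult_ac)
  qed
  have E3: "(1 / sqrt pi) ^ d * exp (- 8 * real d) * real n * r ^ (d - 2)
     \<le> real N * real n * ((r / sqrt pi) ^ d * exp (- 8 * real d))"
  proof -
    have "r ^ (d - 2) * 1 \<le> r ^ (d - 2) * (r\<^sup>2 * real N)"
    proof (rule mult_left_mono)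
      have "r\<^sup>2 * (1 / r\<^sup>2) \<le> r\<^sup>2 * real N" using N1 by (rule mult_left_mono) simp
      then show "1 \<le> r\<^sup>2 * real N" using r(1) by simp
    qed (use r(1) in simp)
    also have "\<dots> = r ^ d * real N"
    proof -
      have "d = (d - 2) + 2" using dim by (simp add: d_def)
      then have "r ^ d = r ^ (d - 2) * r\<^sup>2" by (metis power_add)
      then show ?thesis by simp
    qed
    finally have "(1 / sqrt pi) ^ d * exp (- 8 * real d) * real n * (r ^ (d - 2) * 1)
      \<le> (1 / sqrt pi) ^ d * exp (- 8 * real d) * real n * (r ^ d * real N)"
      by (rule mult_left_mono) (intro mult_nonneg_nonneg zero_le_power; simp)
    moreover have "(r / sqrt pi) ^ d = (1 / sqrt pi) ^ d * r ^ d"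
      by (simp only: power_mult_distrib[symmetric]) simp
    ultimately show ?thesis by (simp only: mult_1_right mult_ac)
  qed
  have "hit_const d * real n * r ^ (d - 2)
      = (1 / sqrt pi) ^ d * exp (- 8 * real d) * real n * r ^ (d - 2) / (2 * K)"
    by (simp only: hit_const_def K_def S_def times_divide_eq_left)
  also have "\<dots> \<le> prob (\<Union>a\<in>I. A a)"
    using order_trans[OF E3 order_trans[OF E2 E1]] K by (simp add: pos_divide_le_eq mult_ac)
  finally have "hit_const d * real n * r ^ (d - 2) \<le> prob (\<Union>a\<in>I. A a)" .
  moreover have "(\<Union>a\<in>I. A a) = {\<omega>\<in>space M. \<exists>k\<in>{N<..2*N}. \<exists>j<n. B (s0 + real k / real N) \<omega> - B s0 \<omega> \<in> cube (C j) r}"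
    by (auto simp: I_def A_def T_def) (use greaterThanAtMost_iff in blast)
  ultimately show ?thesis by (simp add: d_def)
qed

end

section \<open>Avoidance over many time blocks\<close>

text \<open>The form of the Markov property used below: a bound that is uniform in the frozen past \<open>x\<close>
  survives when the past is random and independent of \<open>Y\<close>. It is Fubini for the joint law of \<open>X\<close>
  and \<open>Y\<close>.\<close>

lemma (in prob_space) prob_le_of_frozen_prob_le:
  assumes ind: "indep_var MA X MB Y" and A: "A \<in> sets MA" and G: "G \<in> sets (MA \<Otimes>\<^sub>M MB)"
    and q: "0 \<le> q" "\<And>x. x \<in> space MA \<Longrightarrow> prob {\<omega>\<in>space M. (x, Y \<omega>) \<in> G} \<le> q"
  shows "prob {\<omega>\<in>space M. X \<omega> \<in> A \<and> (X \<omega>, Y \<omega>) \<in> G} \<le> q * prob {\<omega>\<in>space M. X \<omega> \<in> A}"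
proof -
  have X: "random_variable MA X" and Y: "random_variable MB Y"
    and eq: "distr M MA X \<Otimes>\<^sub>M distr M MB Y = distr M (MA \<Otimes>\<^sub>M MB) (\<lambda>x. (X x, Y x))"
    using ind by (auto simp: indep_var_distribution_eq)
  interpret Y: prob_space "distr M MB Y" by (rule prob_space_distr[OF Y])
  define H where "H = G \<inter> (A \<times> space MB)"
  have H: "H \<in> sets (MA \<Otimes>\<^sub>M MB)" using A G by (auto simp: H_def)
  have XY: "(\<lambda>x. (X x, Y x)) \<in> measurable M (MA \<Otimes>\<^sub>M MB)" using X Y by simp
  have "ennreal (prob {\<omega>\<in>space M. X \<omega> \<in> A \<and> (X \<omega>, Y \<omega>) \<in> G})
      = emeasure M ((\<lambda>x. (X x, Y x)) -` H \<inter> space M)"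
    unfolding emeasure_eq_measure H_def using Y[THEN measurable_space]
    by (intro arg_cong[where f = "\<lambda>S. ennreal (prob S)"]) auto
  also have "\<dots> = emeasure (distr M MA X \<Otimes>\<^sub>M distr M MB Y) H"
    unfolding eq using H XY by (simp add: emeasure_distr)
  also have "\<dots> = (\<integral>\<^sup>+x. emeasure (distr M MB Y) (Pair x -` H) \<partial>distr M MA X)"
    using H by (intro Y.emeasure_pair_measure_alt) (simp cong: sets_pair_measure_cong)
  also have "\<dots> \<le> (\<integral>\<^sup>+x. ennreal q * indicator A x \<partial>distr M MA X)"
  proof (rule nn_integral_mono)
    fix x assume "x \<in> space (distr M MA X)"
    then have x: "x \<in> space MA" by simp
    have "emeasure (distr M MB Y) (Pair x -` H) = emeasure M (Y -` (Pair x -` H) \<inter> space M)"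
      using H Y by (intro emeasure_distr) (auto intro: sets_Pair1)
    also have "\<dots> \<le> ennreal q * indicator A x"
    proof (cases "x \<in> A")
      case True
      have "Y -` (Pair x -` H) \<inter> space M = {\<omega>\<in>space M. (x, Y \<omega>) \<in> G}"
        using True Y[THEN measurable_space] by (auto simp: H_def)
      with q(2)[OF x] True show ?thesis by (simp add: emeasure_eq_measure ennreal_leI)
    next
      case False
      then have "Y -` (Pair x -` H) \<inter> space M = {}" by (auto simp: H_def)
      then show ?thesis by simp
    qed
    finally show "emeasure (distr M MB Y) (Pair x -` H) \<le> ennreal q * indicator A x" .
  qed
  also have "\<dots> = ennreal q * emeasure (distr M MA X) A"
    using A by (subst nn_integral_cmult_indicator) auto
  also have "emeasure (distr M MA X) A = emeasure M {\<omega>\<in>space M. X \<omega> \<in> A}"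
    using A X by (subst emeasure_distr) (auto simp: vimage_def Int_def conj_commute)
  also have "ennreal q * \<dots> = ennreal (q * prob {\<omega>\<in>space M. X \<omega> \<in> A})"
    using q(1) by (simp add: emeasure_eq_measure ennreal_mult)
  finally show ?thesis using q(1) by (subst (asm) ennreal_le_iff) auto
qed

context standard_brownian_motion
begin

text \<open>The Markov property, iterated over blocks of length \<open>2\<close>, with a one-block bound that is uniform in
  the starting point. Only the grid times are involved, so that the past and the next block are
  functions of two disjoint finite families of independent increments, \<open>P\<close> and \<open>F\<close> in the proof.\<close>

lemma block_avoidance:
  fixes U :: "(real ^ 'n) set"
  assumes U[measurable]: "U \<in> sets borel" and q: "0 \<le> q"
    and block: "\<And>s y. 0 \<le> s \<Longrightarrow>
      prob {\<omega>\<in>space M. \<forall>k\<in>{N<..2*N}. y + (B (s + real k / real N) \<omega> - B s \<omega>) \<notin> U} \<le> q"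
  shows "prob {\<omega>\<in>space M. \<forall>i<b. \<forall>k\<in>{N<..2*N}. v + B (real (2 * N * i + k) / real N) \<omega> \<notin> U} \<le> q ^ b"
proof (induction b)
  case 0
  then show ?case by simp
next
  case (Suc b)
  define \<tau> where "\<tau> j = real j / real N" for j
  define X where "X j \<omega> = B (\<tau> (Suc j)) \<omega> - B (\<tau> j) \<omega>" for j \<omega>
  have inc: "incseq \<tau>" by (auto simp: \<tau>_def incseq_def divide_right_mono)
  have ind: "indep_vars (\<lambda>_. borel) X {..<2 * N * (b + 1)}"
    unfolding X_def by (rule indep_increments[OF _ inc]) (simp add: \<tau>_def)
  have tele: "(\<Sum>j\<in>{l..<m}. X j \<omega>) = B (\<tau> m) \<omega> - B (\<tau> l) \<omega>" if "l \<le> m" for l m \<omega>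
    unfolding X_def using sum_Suc_diff'[OF that, of "\<lambda>j. B (\<tau> j) \<omega>"] by simp
  have B: "B (\<tau> m) \<omega> = (\<Sum>j<m. X j \<omega>)" if "\<omega> \<in> space M" for m \<omega>
    using tele[of 0 m \<omega>] start_0[OF that] by (simp add: \<tau>_def lessThan_atLeast0)
  define MA where "MA = PiM {..<2 * N * b} (\<lambda>_. borel :: (real ^ 'n) measure)"
  define MB where "MB = PiM {2 * N * b..<2 * N * (b + 1)} (\<lambda>_. borel :: (real ^ 'n) measure)"
  define P where "P \<omega> = restrict (\<lambda>j. X j \<omega>) {..<2 * N * b}" for \<omega>
  define F where "F \<omega> = restrict (\<lambda>j. X j \<omega>) {2 * N * b..<2 * N * (b + 1)}" for \<omega>
  have indPF: "indep_var MA P MB F"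
    unfolding MA_def MB_def P_def F_def by (rule indep_var_restrict[OF ind]) auto
  define A where "A = {p\<in>space MA. \<forall>i<b. \<forall>k\<in>{N<..2*N}. v + (\<Sum>j<2*N*i+k. p j) \<notin> U}"
  define G where "G = {z\<in>space (MA \<Otimes>\<^sub>M MB). \<forall>k\<in>{N<..2*N}.
      (v + (\<Sum>j<2*N*b. fst z j)) + (\<Sum>j\<in>{2*N*b..<2*N*b+k}. snd z j) \<notin> U}"
  have idx: "j < 2 * N * b" if "i < b" "k \<in> {N<..2*N}" "j < 2 * N * i + k" for i j k
  proof -
    have "2 * N * i + k \<le> 2 * N * (i + 1)" using that(2) by auto
    also have "\<dots> \<le> 2 * N * b" using that(1) by (intro mult_le_mono) auto
    finally show ?thesis using that(3) by linarith
  qed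
  have A: "A \<in> sets MA"
  proof -
    have "(\<lambda>p. v + (\<Sum>j<2*N*i+k. p j)) \<in> borel_measurable MA" if "i < b" "k \<in> {N<..2*N}" for i k
      unfolding MA_def using idx[OF that] 
      by (intro borel_measurable_add borel_measurable_const borel_measurable_sum measurable_component_singleton) auto
    then have "{p\<in>space MA. v + (\<Sum>j<2*N*i+k. p j) \<notin> U} \<in> sets MA" if "i < b" "k \<in> {N<..2*N}" for i k
      using that by measurable
    then have "{p\<in>space MA. \<forall>i\<in>{..<b}. \<forall>k\<in>{N<..2*N}. v + (\<Sum>j<2*N*i+k. p j) \<notin> U} \<in> sets MA"
      by (rule sets.sets_Collect_finite_All[OF sets.sets_Collect_finite_All]) simp_all
    then show ?thesis by (simp only: A_def Ball_def lessThan_iff)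
  qed
  have G: "G \<in> sets (MA \<Otimes>\<^sub>M MB)"
  proof -
    have "(\<lambda>z. (v + (\<Sum>j<2*N*b. fst z j)) + (\<Sum>j\<in>{2*N*b..<2*N*b+k}. snd z j)) \<in> borel_measurable (MA \<Otimes>\<^sub>M MB)"
      if "k \<in> {N<..2*N}" for k
      unfolding MA_def MB_def using that
      by (intro borel_measurable_add borel_measurable_const borel_measurable_sum 
          measurable_compose[OF measurable_fst measurable_component_singleton]
          measurable_compose[OF measurable_snd measurable_component_singleton]) auto
    then have "{z\<in>space (MA \<Otimes>\<^sub>M MB). (v + (\<Sum>j<2*N*b. fst z j)) + (\<Sum>j\<in>{2*N*b..<2*N*b+k}. snd z j) \<notin> U} \<in> sets (MA \<Otimes>\<^sub>M MB)"
      if "k \<in> {N<..2*N}" for k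
      using that by measurable
    then show ?thesis unfolding G_def
      by (rule sets.sets_Collect_finite_All) simp_all
  qed
  have spF: "F \<omega> \<in> space MB" and spP: "P \<omega> \<in> space MA" if "\<omega> \<in> space M" for \<omega>
    by (auto simp: F_def P_def MA_def MB_def space_PiM)
  have sumP: "(\<Sum>j<m. P \<omega> j) = B (\<tau> m) \<omega>" if "m \<le> 2 * N * b" "\<omega> \<in> space M" for m \<omega>
    unfolding B[OF that(2)] P_def using that(1) by (intro sum.cong) auto
  have sumF: "(\<Sum>j\<in>{2*N*b..<2*N*b+k}. F \<omega> j) = B (\<tau> (2*N*b+k)) \<omega> - B (\<tau> (2*N*b)) \<omega>" if "k \<le> 2 * N" for k \<omega>
    unfolding tele[OF le_add1, symmetric] F_def using that by (intro sum.cong) auto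
  have Fblock: "prob {\<omega>\<in>space M. (p, F \<omega>) \<in> G} \<le> q" if p: "p \<in> space MA" for p
  proof -
    have \<tau>: "\<tau> (2*N*b+k) = \<tau> (2*N*b) + real k / real N" for k
      by (simp add: \<tau>_def add_divide_distrib)
    have "{\<omega>\<in>space M. (p, F \<omega>) \<in> G}
      = {\<omega>\<in>space M. \<forall>k\<in>{N<..2*N}. (v + (\<Sum>j<2*N*b. p j)) + (B (\<tau> (2*N*b) + real k / real N) \<omega> - B (\<tau> (2*N*b)) \<omega>) \<notin> U}"
      using p spF by (auto simp: G_def space_pair_measure sumF \<tau>)
    then show ?thesis using block[of "\<tau> (2*N*b)" "v + (\<Sum>j<2*N*b. p j)"] by (simp add: \<tau>_def)
  qed
  have past: "P \<omega> \<in> A \<longleftrightarrow> (\<forall>i<b. \<forall>k\<in>{N<..2*N}. v + B (\<tau> (2 * N * i + k)) \<omega> \<notin> U)"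
    if w: "\<omega> \<in> space M" for \<omega>
  proof -
    have "(\<Sum>j<2*N*i+k. P \<omega> j) = B (\<tau> (2*N*i+k)) \<omega>" if "i < b" "k \<in> {N<..2*N}" for i k
      using idx[OF that, of "2*N*i+k-1"] that(2) by (intro sumP w) auto
    then show ?thesis using spP[OF w] by (auto simp: A_def)
  qed
  have future: "(P \<omega>, F \<omega>) \<in> G \<longleftrightarrow> (\<forall>k\<in>{N<..2*N}. v + B (\<tau> (2 * N * b + k)) \<omega> \<notin> U)"
    if w: "\<omega> \<in> space M" for \<omega>
    using spP[OF w] spF[OF w] sumP[OF order.refl w] by (auto simp: G_def space_pair_measure sumF add.assoc)
  have "{\<omega>\<in>space M. \<forall>i<Suc b. \<forall>k\<in>{N<..2*N}. v + B (\<tau> (2 * N * i + k)) \<omega> \<notin> U}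
      = {\<omega>\<in>space M. P \<omega> \<in> A \<and> (P \<omega>, F \<omega>) \<in> G}"
    using past future by (auto simp: less_Suc_eq)
  then have "prob {\<omega>\<in>space M. \<forall>i<Suc b. \<forall>k\<in>{N<..2*N}. v + B (\<tau> (2 * N * i + k)) \<omega> \<notin> U}
      \<le> q * prob {\<omega>\<in>space M. P \<omega> \<in> A}"
    using prob_le_of_frozen_prob_le[OF indPF A G q Fblock] by simp
  also have "\<dots> \<le> q * q ^ b"
  proof (rule mult_left_mono[OF _ q])
    have "{\<omega>\<in>space M. P \<omega> \<in> A} = {\<omega>\<in>space M. \<forall>i<b. \<forall>k\<in>{N<..2*N}. v + B (\<tau> (2 * N * i + k)) \<omega> \<notin> U}"
      using past by auto
    with Suc.IH show "prob {\<omega>\<in>space M. P \<omega> \<in> A} \<le> q ^ b" by (simp add: \<tau>_def)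
  qed
  finally show ?case by (simp add: \<tau>_def)
qed

end

section \<open>Discretised configurations and the union bound\<close>

lemma countable_integer_lattice: "countable (integer_lattice :: (real ^ 'n::finite) set)"
proof -
  have "integer_lattice \<subseteq> range (\<lambda>f :: 'n \<Rightarrow> int. \<chi> i. of_int (f i))"
  proof
    fix z :: "real ^ 'n" assume "z \<in> integer_lattice"
    then have "z = (\<chi> i. of_int \<lfloor>z $ i\<rfloor>)"
      by (auto simp: integer_lattice_def vec_eq_iff elim!: Ints_cases)
    then show "z \<in> range (\<lambda>f :: 'n \<Rightarrow> int. \<chi> i. of_int (f i))"
      by (rule range_eqI[where x = "\<lambda>i. \<lfloor>z $ i\<rfloor>"])
  qed
  then show ?thesis by (rule countable_subset) auto
qed

text \<open>The set of positions in Euclidean space from which the projection to the torus lies in one of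
  the projected cubes.\<close>

definition periodic_cubes :: "(nat \<Rightarrow> real ^ 'n::finite) \<Rightarrow> nat \<Rightarrow> real \<Rightarrow> (real ^ 'n) set" where
  "periodic_cubes c n r = (\<Union>j<n. \<Union>z\<in>integer_lattice. {v. v - z \<in> cube (c j) r})"

lemma sets_periodic_cubes [measurable]: "periodic_cubes c n r \<in> sets borel"
proof -
  have "{v. v - z \<in> cube (c j) r} \<in> sets borel" for z j
    using measurable_sets[of "\<lambda>v. v - z" borel borel "cube (c j) r"] by (simp add: vimage_def)
  then show ?thesis unfolding periodic_cubes_def
    by (intro sets.finite_UN sets.countable_UN' countable_integer_lattice) auto
qed

definition int_box :: "int \<Rightarrow> int \<Rightarrow> ('n \<Rightarrow> int) set" where
  "int_box l u = {f. \<forall>i. l \<le> f i \<and> f i \<le> u}"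

lemma int_box_eq_PiE: "int_box l u = PiE UNIV (\<lambda>_. {l..u})"
  by (auto simp: int_box_def)

lemma finite_int_box: "finite (int_box l u :: ('n::finite \<Rightarrow> int) set)"
  unfolding int_box_eq_PiE by (intro finite_PiE) auto

lemma card_int_box: "card (int_box l u :: ('n::finite \<Rightarrow> int) set) = nat (u - l + 1) ^ CARD('n)"
  unfolding int_box_eq_PiE by (subst card_PiE) auto

text \<open>A configuration consists of a grid cell \<open>fst g\<close> and of displacements \<open>snd g k\<close> relative to it, all
  in units of \<open>r\<close>. The separation into base point and displacements matters for the count: the base
  point is chosen among polynomially many in \<open>1 / r\<close>, but the displacements among only
  polynomially many in \<open>n\<close>.\<close>

definition grid_centres :: "real \<Rightarrow> ('n::finite \<Rightarrow> int) \<times> (nat \<Rightarrow> 'n \<Rightarrow> int) \<Rightarrow> nat \<Rightarrow> real ^ 'n" where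
  "grid_centres r g k = (\<chi> i. r * of_int (fst g i + snd g k i))"

definition separated :: "nat \<Rightarrow> real \<Rightarrow> (nat \<Rightarrow> real ^ 'n::finite) \<Rightarrow> bool" where
  "separated n r c \<longleftrightarrow> (\<forall>i<n. \<forall>j<n. i \<noteq> j \<longrightarrow> 4 * real CARD('n) * (real n)\<^sup>2 * r \<le> dist (c i) (c j))"

definition grid_configurations :: "nat \<Rightarrow> real \<Rightarrow> (('n::finite \<Rightarrow> int) \<times> (nat \<Rightarrow> 'n \<Rightarrow> int)) set" where
  "grid_configurations n r =
    int_box 0 \<lfloor>1 / r\<rfloor> \<times>
    PiE {..<n} (\<lambda>_. int_box (- int (9 * CARD('n) * n ^ 3)) (int (9 * CARD('n) * n ^ 3)))"

lemma finite_grid_configurations: "finite (grid_configurations n r)"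
  unfolding grid_configurations_def by (intro finite_cartesian_product finite_PiE finite_int_box) auto

lemma card_grid_configurations:
  assumes "0 < r"
  shows "real (card (grid_configurations n r :: (('n::finite \<Rightarrow> int) \<times> (nat \<Rightarrow> 'n \<Rightarrow> int)) set))
    \<le> (1 / r + 1) ^ CARD('n) * (real (18 * CARD('n) * n ^ 3 + 1) ^ CARD('n)) ^ n"
proof -
  let ?H = "int (9 * CARD('n) * n ^ 3)"
  have "card (grid_configurations n r :: (('n::finite \<Rightarrow> int) \<times> (nat \<Rightarrow> 'n \<Rightarrow> int)) set)
    = nat (\<lfloor>1 / r\<rfloor> + 1) ^ CARD('n) * (nat (?H - (- ?H) + 1) ^ CARD('n)) ^ n"
    unfolding grid_configurations_def by (subst card_cartesian_product, subst card_PiE) (auto simp: card_int_box)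
  also have "?H - (- ?H) + 1 = int (18 * CARD('n) * n ^ 3 + 1)" by simp
  also have "nat (int (18 * CARD('n) * n ^ 3 + 1)) = 18 * CARD('n) * n ^ 3 + 1" by (rule nat_int)
  finally have "real (card (grid_configurations n r :: (('n::finite \<Rightarrow> int) \<times> (nat \<Rightarrow> 'n \<Rightarrow> int)) set))
    = real (nat (\<lfloor>1 / r\<rfloor> + 1)) ^ CARD('n) * (real (18 * CARD('n) * n ^ 3 + 1) ^ CARD('n)) ^ n"
    by simp
  also have "\<dots> \<le> (1 / r + 1) ^ CARD('n) * (real (18 * CARD('n) * n ^ 3 + 1) ^ CARD('n)) ^ n"
  proof (intro mult_right_mono power_mono)
    have "0 \<le> \<lfloor>1 / r\<rfloor>" using assms by simp
    then show "real (nat (\<lfloor>1 / r\<rfloor> + 1)) \<le> 1 / r + 1" by linarith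
  qed auto
  finally show ?thesis .
qed

text \<open>The points of the wrapping component are rounded to the grid of mesh \<open>r\<close>. Both the rounding and
  the cubes have size at most \<open>d r = \<rho> / 4\<close>, so a path that enters a cube comes within \<open>\<rho> / 2\<close> of
  an uncovered point, which is impossible. The spacing \<open>R\<close> is twice what is needed for the
  separation of the centres, and so leaves room for the rounding errors; the factor \<open>64\<close> in the
  smallness assumption makes \<open>n R\<close> at most \<open>1/8\<close>.\<close>

lemma grid_configuration_of_wrapping_path:
  fixes w :: "real \<Rightarrow> 'n::finite torus"
  defines "d \<equiv> real CARD('n)"
  assumes w: "wraps w t \<rho>" and \<rho>: "0 < \<rho>" and r: "r = \<rho> / (4 * d)"
    and small: "64 * d * real n ^ 3 * r \<le> 1" and n: "1 \<le> n"
  obtains g where "g \<in> grid_configurations n r" "separated n r (grid_centres r g)"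
    "\<And>s v. s \<in> {0..t} \<Longrightarrow> torus_proj v = w s \<Longrightarrow> v \<notin> periodic_cubes (grid_centres r g) n r"
proof -
  have d1: "1 \<le> d" by (simp add: d_def Suc_le_eq)
  have r0: "0 < r" and rho: "\<rho> = 4 * d * r" using \<rho> d1 by (auto simp: r)
  define R where "R = 2 * (real n)\<^sup>2 * \<rho>"
  have R0: "0 < R" using \<rho> n by (simp add: R_def)
  have nR: "real n * R = 8 * d * real n ^ 3 * r"
    by (simp add: R_def rho power2_eq_square power3_eq_cube)
  have "real n * R \<le> 1 / 8" using small by (simp add: nR)
  from wraps_separated_points[OF w less_imp_le[OF R0] this] obtain x where
    x: "\<And>k s. k < n \<Longrightarrow> s \<in> {0..t} \<Longrightarrow> dist (w s) (x k) > \<rho>"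
       "\<And>k. k < n \<Longrightarrow> dist (x 0) (x k) = real k * R" by blast
  obtain a' where a': "torus_proj a' = x 0" using torus_proj_surj by blast
  define a where "a = (\<chi> i. frac (a' $ i))"
  have "a - a' \<in> integer_lattice"
    by (simp add: a_def integer_lattice_def frac_def)
  then have a: "torus_proj a = x 0" using a' by (metis torus_proj_eq_iff)
  have a01: "0 \<le> a $ i" "a $ i \<le> 1" for i by (auto simp: a_def frac_lt_1 less_imp_le)
  have "\<exists>y. torus_proj y = x k \<and> dist a y < real n * R" if "k < n" for k
  proof -
    have "dist (torus_proj a) (x k) < real n * R"
      using x(2)[OF that] that R0 by (simp add: a)
    then show ?thesis using torus_lift_near by metis
  qed
  then obtain y where y: "\<And>k. k < n \<Longrightarrow> torus_proj (y k) = x k" "\<And>k. k < n \<Longrightarrow> dist a (y k) < real n * R"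
    by metis
  define f where "f i = \<lfloor>a $ i / r\<rfloor>" for i
  define u where "u = restrict (\<lambda>k i. \<lfloor>y k $ i / r\<rfloor> - f i) {..<n}"
  define g where "g = (f, u)"
  have c: "grid_centres r g k = (\<chi> i. r * of_int \<lfloor>y k $ i / r\<rfloor>)" if "k < n" for k
    using that by (simp add: grid_centres_def g_def u_def vec_eq_iff)
  have near: "y k \<in> cube (grid_centres r g k) r" if "k < n" for k
    unfolding cube_def c[OF that]
  proof (clarsimp)
    fix i
    have "y k $ i = r * (y k $ i / r)" using r0 by simp
    moreover have "r * of_int \<lfloor>y k $ i / r\<rfloor> \<le> r * (y k $ i / r)" "r * (y k $ i / r) \<le> r * (of_int \<lfloor>y k $ i / r\<rfloor> + 1)"
      using r0 by (intro mult_left_mono; linarith)+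
    ultimately show "\<bar>y k $ i - r * of_int \<lfloor>y k $ i / r\<rfloor>\<bar> \<le> r" by (simp add: algebra_simps abs_le_iff)
  qed
  have dist_near: "dist v (y k) \<le> 2 * d * r" if "v \<in> cube (grid_centres r g k) r" "k < n" for v k
    using dist_le_of_mem_cube[OF that(1)] dist_le_of_mem_cube[OF near[OF that(2)]]
      dist_triangle2[of v "y k" "grid_centres r g k"] by (simp add: d_def)
  show thesis
  proof (rule that)
    show "g \<in> grid_configurations n r"
    proof -
      have "f \<in> int_box 0 \<lfloor>1 / r\<rfloor>"
        using a01 r0 by (auto simp: f_def int_box_def intro!: floor_mono divide_right_mono)
      moreover have "u k \<in> int_box (- int (9 * CARD('n) * n ^ 3)) (int (9 * CARD('n) * n ^ 3))" if "k < n" for k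
        unfolding int_box_def
      proof (clarify)
        fix i
        have "\<bar>y k $ i - a $ i\<bar> \<le> dist a (y k)"
          using component_le_norm_cart[of "y k - a" i] by (simp add: dist_norm norm_minus_commute)
        also have "\<dots> \<le> (8 * d * real n ^ 3) * r" using y(2)[OF that] by (simp add: nR)
        finally have "\<bar>y k $ i - a $ i\<bar> / r \<le> 8 * d * real n ^ 3"
          using r0 by (simp add: divide_le_eq)
        then have "\<bar>y k $ i / r - a $ i / r\<bar> \<le> 8 * d * real n ^ 3"
          using r0 by (simp add: diff_divide_distrib[symmetric])
        then have "\<bar>of_int (u k i)\<bar> \<le> 8 * d * real n ^ 3 + 1"
          using that by (simp add: u_def f_def) linarith
        moreover have "1 \<le> d * real n ^ 3"
          using mult_mono[of 1 d 1 "real n ^ 3"] d1 n by (simp add: one_le_power)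
        ultimately have "\<bar>of_int (u k i) :: real\<bar> \<le> of_int (int (9 * CARD('n) * n ^ 3))"
          by (simp add: d_def)
        then have "\<bar>u k i\<bar> \<le> int (9 * CARD('n) * n ^ 3)" by linarith
        then show "- int (9 * CARD('n) * n ^ 3) \<le> u k i \<and> u k i \<le> int (9 * CARD('n) * n ^ 3)"
          by linarith
      qed
      ultimately show ?thesis
        by (auto simp: g_def grid_configurations_def u_def)
    qed
    show "separated n r (grid_centres r g)"
      unfolding separated_def
    proof (intro allI impI)
      fix i j assume ij: "i < n" "j < n" "i \<noteq> j"
      have "1 \<le> \<bar>real i - real j\<bar>" using ij(3) by linarith
      then have "1 * R \<le> \<bar>real i - real j\<bar> * R" using R0 by (intro mult_right_mono) auto
      also have "\<dots> = \<bar>dist (x 0) (x i) - dist (x 0) (x j)\<bar>"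
        using x(2) ij R0 by (simp add: abs_mult left_diff_distrib[symmetric])
      also have "\<dots> \<le> dist (x i) (x j)"
        using dist_triangle[of "x 0" "x i" "x j"] dist_triangle[of "x 0" "x j" "x i"]
        by (simp add: dist_commute abs_le_iff)
      also have "\<dots> \<le> dist (y i) (y j)"
        using dist_torus_proj_le[of "y i" "y j"] y(1) ij by simp
      also have "\<dots> \<le> dist (y i) (grid_centres r g i) + dist (grid_centres r g i) (grid_centres r g j) + dist (y j) (grid_centres r g j)"
        using dist_triangle[of "y i" "y j" "grid_centres r g i"]
          dist_triangle[of "grid_centres r g i" "y j" "grid_centres r g j"] by (simp add: dist_commute)
      also have "\<dots> \<le> dist (grid_centres r g i) (grid_centres r g j) + 2 * d * r"
        using dist_le_of_mem_cube[OF near[OF ij(1)]] dist_le_of_mem_cube[OF near[OF ij(2)]] by (simp add: d_def)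
      finally have 1: "8 * (real n)\<^sup>2 * d * r \<le> dist (grid_centres r g i) (grid_centres r g j) + 2 * d * r"
        by (simp add: R_def rho mult_ac)
      have "1 * (d * r) \<le> (real n)\<^sup>2 * (d * r)"
        using n d1 r0 by (intro mult_right_mono) (auto simp: one_le_power)
      moreover have "0 \<le> d * r" using d1 r0 by simp
      ultimately show "4 * real CARD('n) * (real n)\<^sup>2 * r \<le> dist (grid_centres r g i) (grid_centres r g j)"
        unfolding d_def[symmetric] using 1 by (simp add: mult_ac)
    qed
    fix s v assume s: "s \<in> {0..t}" and v: "torus_proj v = w s"
    show "v \<notin> periodic_cubes (grid_centres r g) n r"
    proof
      assume "v \<in> periodic_cubes (grid_centres r g) n r"
      then obtain k z where kz: "k < n" "z \<in> integer_lattice" "v - z \<in> cube (grid_centres r g k) r"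
        by (auto simp: periodic_cubes_def)
      have "torus_proj (v - z) = w s"
        using kz(2) v by (metis add_diff_cancel_left' diff_add_cancel integer_lattice_minus minus_diff_eq torus_proj_eq_iff)
      then have "dist (w s) (x k) \<le> dist (v - z) (y k)"
        using dist_torus_proj_le[of "v - z" "y k"] y(1)[OF kz(1)] by simp
      also have "\<dots> \<le> 2 * d * r" by (rule dist_near[OF kz(3,1)])
      also have "\<dots> \<le> \<rho>" using d1 r0 by (simp add: rho)
      finally show False using x(1)[OF kz(1) s] by simp
    qed
  qed
qed

context standard_brownian_motion
begin

text \<open>Whatever the current position \<open>y\<close>, a lattice vector \<open>z\<close> brings all centres simultaneously within
  coordinate distance \<open>3\<close> of it, because they are close to each other. Hitting these particular lifts
  within one block suffices, which reduces the torus to Euclidean space.\<close>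

lemma block_avoid_periodic_cubes:
  fixes y :: "real ^ 'n"
  assumes dim: "3 \<le> CARD('n)" and s: "0 \<le> s" and r: "0 < r" and n: "1 \<le> n"
    and small: "64 * real CARD('n) * real n ^ 3 * r \<le> 1"
    and N: "N = nat \<lceil>1 / r\<^sup>2\<rceil>"
    and g: "g \<in> grid_configurations n r" and sep: "separated n r (grid_centres r g)"
  shows "prob {\<omega>\<in>space M. \<forall>k\<in>{N<..2*N}. y + (B (s + real k / real N) \<omega> - B s \<omega>) \<notin> periodic_cubes (grid_centres r g) n r}
    \<le> exp (- (hit_const CARD('n) * real n * r ^ (CARD('n) - 2)))"
proof -
  let ?U = "periodic_cubes (grid_centres r g) n r"
  define c where "c = grid_centres r g"
  define z :: "real ^ 'n" where "z = (\<chi> i. - of_int \<lfloor>c 0 $ i - y $ i\<rfloor>)"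
  have z: "z \<in> integer_lattice" by (simp add: z_def integer_lattice_def)
  define C where "C j = c j - y + z" for j
  define m where "m = real CARD('n) * real n ^ 3"
  have "1 * 1 \<le> m"
    unfolding m_def by (rule mult_mono) (use n dim in \<open>auto simp: one_le_power\<close>)
  then have "1 * r \<le> m * r" by (intro mult_right_mono less_imp_le[OF r]) simp
  moreover have "64 * (m * r) \<le> 1" using small by (simp only: m_def mult.assoc)
  ultimately have r1: "r \<le> 1" using r by linarith
  have Cbd: "\<bar>C j $ i\<bar> \<le> 3" if j: "j < n" for j i
  proof -
    have u: "\<bar>snd g k i\<bar> \<le> int (9 * CARD('n) * n ^ 3)" if "k < n" for k
    proof -
      have "snd g \<in> PiE {..<n} (\<lambda>_. int_box (- int (9 * CARD('n) * n ^ 3)) (int (9 * CARD('n) * n ^ 3)))"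
        using g by (simp only: grid_configurations_def mem_Times_iff)
      then have "snd g k \<in> int_box (- int (9 * CARD('n) * n ^ 3)) (int (9 * CARD('n) * n ^ 3))"
        by (rule PiE_mem) (use that in simp)
      then have "- int (9 * CARD('n) * n ^ 3) \<le> snd g k i \<and> snd g k i \<le> int (9 * CARD('n) * n ^ 3)"
        by (simp only: int_box_def mem_Collect_eq)
      then show ?thesis by linarith
    qed
    have "\<bar>snd g j i - snd g 0 i\<bar> \<le> 18 * int (CARD('n) * n ^ 3)"
      using u[OF j] u[of 0] n by simp
    then have "real_of_int \<bar>snd g j i - snd g 0 i\<bar> \<le> real_of_int (18 * int (CARD('n) * n ^ 3))"
      by (simp only: of_int_le_iff)
    then have "\<bar>of_int (snd g j i) - of_int (snd g 0 i)\<bar> \<le> 18 * m"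
      by (simp add: m_def)
    then have "r * \<bar>of_int (snd g j i) - of_int (snd g 0 i)\<bar> \<le> r * (18 * m)"
      by (rule mult_left_mono[OF _ less_imp_le[OF r]])
    also have "\<dots> \<le> 64 * (m * r)" using \<open>1 * 1 \<le> m\<close> r by simp
    also have "\<dots> \<le> 1" by fact
    finally have "r * \<bar>of_int (snd g j i) - of_int (snd g 0 i)\<bar> \<le> 1" .
    moreover have "c j $ i - c 0 $ i = r * (of_int (snd g j i) - of_int (snd g 0 i))"
      by (simp add: c_def grid_centres_def algebra_simps)
    ultimately have "\<bar>c j $ i - c 0 $ i\<bar> \<le> 1" using r by (simp add: abs_mult)
    moreover have "C j $ i = (c j $ i - c 0 $ i) + (c 0 $ i - y $ i - of_int \<lfloor>c 0 $ i - y $ i\<rfloor>)"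
      by (simp add: C_def z_def)
    ultimately show ?thesis by linarith
  qed
  have Csep: "4 * real CARD('n) * (real n)\<^sup>2 * r \<le> dist (C i) (C j)" if "i < n" "j < n" "i \<noteq> j" for i j
    using sep that by (simp add: separated_def C_def c_def dist_norm)
  let ?hit = "{\<omega>\<in>space M. \<exists>k\<in>{N<..2*N}. \<exists>j<n. B (s + real k / real N) \<omega> - B s \<omega> \<in> cube (C j) r}"
  let ?avoid = "{\<omega>\<in>space M. \<forall>k\<in>{N<..2*N}. y + (B (s + real k / real N) \<omega> - B s \<omega>) \<notin> ?U}"
  define p where "p = hit_const CARD('n) * real n * r ^ (CARD('n) - 2)"
  have hit: "p \<le> prob ?hit"
    unfolding p_def by (rule block_hit_prob[OF dim s r r1 N Cbd Csep])
  have hitev: "?hit \<in> events"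
  proof -
    have "?hit = (\<Union>k\<in>{N<..2*N}. \<Union>j<n. {\<omega>\<in>space M. B (s + real k / real N) \<omega> - B s \<omega> \<in> cube (C j) r})"
      by blast
    also have "\<dots> \<in> events"
      using s by (intro sets.finite_UN event_increment_cube) auto
    finally show ?thesis .
  qed
  have "?avoid \<subseteq> space M - ?hit"
  proof clarify
    fix \<omega> k j
    assume av: "\<forall>k\<in>{N<..2*N}. y + (B (s + real k / real N) \<omega> - B s \<omega>) \<notin> ?U"
      and kj: "k \<in> {N<..2*N}" "j < n" "B (s + real k / real N) \<omega> - B s \<omega> \<in> cube (C j) r"
    let ?S = "B (s + real k / real N) \<omega> - B s \<omega>"
    have "?S $ i - C j $ i = (y + ?S - z) $ i - c j $ i" for i
      by (simp add: C_def)
    with kj(3) have "y + ?S - z \<in> cube (c j) r"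
      by (simp only: cube_def mem_Collect_eq) simp
    then have "y + ?S \<in> ?U" using kj(2) z unfolding periodic_cubes_def c_def by blast
    with av kj(1) show False by blast
  qed
  then have "prob ?avoid \<le> prob (space M - ?hit)"
    by (rule finite_measure_mono[OF _ sets.compl_sets[OF hitev]])
  also have "\<dots> = 1 - prob ?hit" using hitev by (rule prob_compl)
  also have "\<dots> \<le> 1 + - p" using hit by linarith
  also have "\<dots> \<le> exp (- p)" by (rule exp_ge_add_one_self)
  finally show ?thesis unfolding p_def .
qed

lemma wraps_prob_le:
  fixes x\<^sub>0 :: "'n torus"
  assumes dim: "3 \<le> CARD('n)" and \<rho>: "0 < \<rho>" and r: "r = \<rho> / (4 * real CARD('n))"
    and n: "1 \<le> n" and small: "64 * real CARD('n) * real n ^ 3 * r \<le> 1" and t: "0 \<le> t"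
  shows "prob {\<omega>\<in>space M. wraps (\<lambda>s. torus_shift x\<^sub>0 (B s \<omega>)) t \<rho>}
    \<le> (1 / r + 1) ^ CARD('n) * (real (18 * CARD('n) * n ^ 3 + 1) ^ CARD('n)) ^ n
       * exp (- (hit_const CARD('n) * real n * r ^ (CARD('n) - 2) * real (nat \<lfloor>t / 2\<rfloor>)))"
    (is "prob ?W \<le> ?card * exp (- (?p * real ?b))")
proof -
  obtain v where v: "torus_proj v = x\<^sub>0" using torus_proj_surj by blast
  have r0: "0 < r" using \<rho> dim by (simp add: r)
  define N where "N = nat \<lceil>1 / r\<^sup>2\<rceil>"
  have N0: "0 < N" using r0 by (simp add: N_def)
  define G where "G = {g\<in>grid_configurations n r. separated n r (grid_centres r g :: nat \<Rightarrow> real ^ 'n)}"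
  have finG: "finite G" by (simp add: G_def finite_grid_configurations)
  define E where "E g = {\<omega>\<in>space M. \<forall>i<?b. \<forall>k\<in>{N<..2*N}. v + B (real (2 * N * i + k) / real N) \<omega> \<notin> periodic_cubes (grid_centres r g) n r}" for g
  have E: "E g \<in> events" for g
  proof -
    have "{\<omega>\<in>space M. v + B (real m / real N) \<omega> \<notin> periodic_cubes (grid_centres r g) n r} \<in> events" for m
    proof -
      have "(\<lambda>\<omega>. v + B (real m / real N) \<omega>) \<in> borel_measurable M"
        by (intro borel_measurable_add borel_measurable_const measurable_at) simp
      then show ?thesis by measurable
    qed
    then have "{\<omega>\<in>space M. \<forall>i\<in>{..<?b}. \<forall>k\<in>{N<..2*N}. v + B (real (2 * N * i + k) / real N) \<omega> \<notin> periodic_cubes (grid_centres r g) n r} \<in> events"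
      by (rule sets.sets_Collect_finite_All[OF sets.sets_Collect_finite_All]) simp_all
    then show ?thesis by (simp only: E_def Ball_def lessThan_iff)
  qed
  have PE: "prob (E g) \<le> exp (- (?p * real ?b))" if "g \<in> G" for g
  proof -
    have "prob (E g) \<le> exp (- ?p) ^ ?b"
      unfolding E_def
      by (rule block_avoidance[OF sets_periodic_cubes exp_ge_zero])
        (use that in \<open>auto simp: G_def intro!: block_avoid_periodic_cubes[OF dim _ r0 n small N_def]\<close>)
    also have "\<dots> = exp (- (?p * real ?b))" by (simp add: exp_of_nat_mult[symmetric] mult_ac)
    finally show ?thesis .
  qed
  have sub: "?W \<subseteq> (\<Union>g\<in>G. E g)"
  proof clarify
    fix \<omega> assume \<omega>: "\<omega> \<in> space M" and w: "wraps (\<lambda>s. torus_shift x\<^sub>0 (B s \<omega>)) t \<rho>"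
    obtain g where g: "g \<in> grid_configurations n r" "separated n r (grid_centres r g :: nat \<Rightarrow> real ^ 'n)"
      "\<And>s u. s \<in> {0..t} \<Longrightarrow> torus_proj u = torus_shift x\<^sub>0 (B s \<omega>) \<Longrightarrow> u \<notin> periodic_cubes (grid_centres r g) n r"
      using grid_configuration_of_wrapping_path[OF w \<rho> r small n] by blast
    have "v + B (real (2 * N * i + k) / real N) \<omega> \<notin> periodic_cubes (grid_centres r g) n r"
      if "i < ?b" "k \<in> {N<..2*N}" for i k
    proof (rule g(3))
      have "2 * N * i + k \<le> 2 * N * (i + 1)" using that(2) by auto
      also have "\<dots> \<le> 2 * N * ?b" using that(1) by (intro mult_le_mono) auto
      finally have "real (2 * N * i + k) \<le> real (2 * N * ?b)" by (rule of_nat_mono)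
      then have "real (2 * N * i + k) / real N \<le> 2 * real ?b"
        using N0 by (simp add: divide_le_eq mult_ac)
      moreover have "2 * real ?b \<le> t" using t by linarith
      ultimately show "real (2 * N * i + k) / real N \<in> {0..t}" by simp
      show "torus_proj (v + B (real (2 * N * i + k) / real N) \<omega>) = torus_shift x\<^sub>0 (B (real (2 * N * i + k) / real N) \<omega>)"
        by (simp add: v[symmetric] torus_shift_proj)
    qed
    then have "\<omega> \<in> E g" using \<omega> unfolding E_def by blast
    then show "\<omega> \<in> (\<Union>g\<in>G. E g)" using g(1,2) unfolding G_def by blast
  qed
  \<comment> \<open>\<open>?W\<close> may fail to be an event, in which case it has measure \<open>0\<close>; monotonicity only asks for a
     measurable superset.\<close>
  have "prob ?W \<le> prob (\<Union>g\<in>G. E g)"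
    using sub E finG by (intro finite_measure_mono) auto
  also have "\<dots> \<le> (\<Sum>g\<in>G. prob (E g))"
    using finG E by (intro finite_measure_subadditive_finite) auto
  also have "\<dots> \<le> (\<Sum>g\<in>G. exp (- (?p * real ?b)))" by (intro sum_mono PE)
  also have "\<dots> = real (card G) * exp (- (?p * real ?b))" by simp
  also have "\<dots> \<le> ?card * exp (- (?p * real ?b))"
  proof (rule mult_right_mono)
    have "card G \<le> card (grid_configurations n r :: (('n \<Rightarrow> int) \<times> (nat \<Rightarrow> 'n \<Rightarrow> int)) set)"
      unfolding G_def by (intro card_mono finite_grid_configurations) auto
    then have "real (card G) \<le> real (card (grid_configurations n r :: (('n \<Rightarrow> int) \<times> (nat \<Rightarrow> 'n \<Rightarrow> int)) set))"
      by (rule of_nat_mono)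
    then show "real (card G) \<le> ?card"
      by (rule order_trans[OF _ card_grid_configurations[OF r0]])
  qed (rule exp_ge_zero)
  finally show ?thesis .
qed

end

section \<open>Asymptotics of the radius\<close>

lemma kappa_pos: "3 \<le> d \<Longrightarrow> 0 < kappa d"
  unfolding kappa_def by (intro divide_pos_pos Gamma_real_pos) auto

text \<open>The \<open>(d - 2)\<close>-th power of \<open>phi\<close> is the natural quantity, since hitting probabilities scale with
  the \<open>(d - 2)\<close>-th power of the radius.\<close>

lemma phi_power:
  assumes d: "3 \<le> d" and t: "1 < t"
  shows "phi d t ^ (d - 2) = real d / ((real d - 2) * kappa d) * (ln t / t)"
proof -
  have X: "0 < real d / ((real d - 2) * kappa d) * (ln t / t)"
    using d t kappa_pos[OF d] by (intro mult_pos_pos divide_pos_pos) auto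
  have e: "real (d - 2) = real d - 2" using d by simp
  have "phi d t ^ (d - 2) = phi d t powr real (d - 2)"
    using X d by (subst powr_realpow) (auto simp: phi_def)
  also have "\<dots> = real d / ((real d - 2) * kappa d) * (ln t / t)"
  proof -
    have "(Y powr (1 / (real d - 2))) powr (real d - 2) = Y" if "0 < Y" for Y
      using d that by (simp add: powr_powr)
    from this[OF X] show ?thesis by (simp only: phi_def e)
  qed
  finally show ?thesis .
qed

text \<open>The lower bound on the radius in the form in which it is used: the expected number of blocks in
  which a single ball of radius \<open>\<rho> t\<close> is hit grows faster than \<open>ln t powr (2 / d)\<close>. The exponent is
  \<open>1 - (d - 2) / d\<close>, with \<open>1\<close> from \<open>phi\<close> and the rest from the factor \<open>ln t powr (1 / d)\<close>.\<close>

lemma radius_power_eventually_ge: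
  assumes d: "3 \<le> d"
    and lower: "filterlim (\<lambda>t. ln t powr (1 / real d) * \<rho> t / phi d t) at_top at_top"
  shows "eventually (\<lambda>t. K * ln t powr (2 / real d) \<le> t * \<rho> t ^ (d - 2)) at_top"
proof -
  define a where "a = real d / ((real d - 2) * kappa d)"
  have a: "0 < a" using d kappa_pos[OF d] by (auto simp: a_def intro!: divide_pos_pos mult_pos_pos)
  have "eventually (\<lambda>t. max 1 (K / a) \<le> ln t powr (1 / real d) * \<rho> t / phi d t) at_top"
    using lower by (rule filterlim_at_top[THEN iffD1, rule_format])
  moreover have "eventually (\<lambda>t :: real. 1 < t) at_top" by (rule eventually_gt_at_top)
  ultimately show ?thesis
  proof eventually_elim
    case (elim t)
    let ?g = "max 1 (K / a)"
    have ln: "0 < ln t" using elim by simp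
    have phi: "0 < phi d t"
      using a elim ln unfolding phi_def a_def[symmetric] by simp
    have "?g \<le> ?g ^ (d - 2)"
      using power_increasing[of 1 "d - 2" ?g] d by simp
    also have "?g ^ (d - 2) \<le> (ln t powr (1 / real d) * \<rho> t / phi d t) ^ (d - 2)"
      by (rule power_mono[OF elim(1)]) simp
    also have "\<dots> = (ln t powr (1 / real d)) ^ (d - 2) * \<rho> t ^ (d - 2) / (a * (ln t / t))"
      using phi_power[OF d elim(2)] by (simp add: power_mult_distrib power_divide a_def)
    also have "(ln t powr (1 / real d)) ^ (d - 2) = ln t powr (1 - 2 / real d)"
    proof -
      have "(ln t powr (1 / real d)) ^ (d - 2) = (ln t powr (1 / real d)) powr real (d - 2)"
        using ln by (subst powr_realpow) auto
      also have "\<dots> = ln t powr (1 - 2 / real d)"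
        using d by (simp add: powr_powr field_simps of_nat_diff)
      finally show ?thesis .
    qed
    also have "ln t powr (1 - 2 / real d) * \<rho> t ^ (d - 2) / (a * (ln t / t))
        = ln t powr (- 2 / real d) * (t * \<rho> t ^ (d - 2)) / a"
    proof -
      have "ln t powr (1 - 2 / real d) = ln t * ln t powr (- 2 / real d)"
        using ln powr_add[of "ln t" 1 "- 2 / real d"] by simp
      then show ?thesis using ln a elim by (simp add: field_simps)
    qed
    finally have "?g * a \<le> ln t powr (- 2 / real d) * (t * \<rho> t ^ (d - 2))"
      using a by (simp only: pos_le_divide_eq)
    then have "?g * a * ln t powr (2 / real d) \<le> ln t powr (- 2 / real d) * (t * \<rho> t ^ (d - 2)) * ln t powr (2 / real d)"
      by (rule mult_right_mono) simp
    also have "\<dots> = t * \<rho> t ^ (d - 2)"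
      using ln by (simp add: powr_minus field_simps)
    finally have "?g * a * ln t powr (2 / real d) \<le> t * \<rho> t ^ (d - 2)" .
    moreover have "K / a * a \<le> ?g * a" using a by (intro mult_right_mono) auto
    then have "K * ln t powr (2 / real d) \<le> ?g * a * ln t powr (2 / real d)"
      using a by (intro mult_right_mono) auto
    ultimately show ?case by linarith
  qed
qed

lemma radius_eventually_small:
  assumes d: "3 \<le> d"
    and upper: "((\<lambda>t. \<rho> t / phi d t) \<longlongrightarrow> 0) at_top"
    and e: "0 < e"
  shows "eventually (\<lambda>t. \<rho> t * (ln t + 1) ^ 3 \<le> e) at_top"
proof -
  define a where "a = real d / ((real d - 2) * kappa d)"
  define b where "b = 1 / (real d - 2)"
  have a: "0 < a" using d kappa_pos[OF d] by (auto simp: a_def intro!: divide_pos_pos mult_pos_pos)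
  have b: "0 < b" using d by (simp add: b_def)
  have "((\<lambda>t. (a * (ln t / t)) powr b * (ln t + 1) ^ 3) \<longlongrightarrow> 0) at_top"
    using a b by real_asymp
  then have "eventually (\<lambda>t. (a * (ln t / t)) powr b * (ln t + 1) ^ 3 < e) at_top"
    using e by (rule order_tendstoD(2))
  moreover have "eventually (\<lambda>t. \<rho> t / phi d t < 1) at_top"
    using upper by (rule order_tendstoD(2)) simp
  moreover have "eventually (\<lambda>t :: real. 1 < t) at_top" by (rule eventually_gt_at_top)
  ultimately show ?thesis
  proof eventually_elim
    case (elim t)
    have ln: "0 < ln t" using elim by simp
    have phi: "0 < phi d t" "phi d t = (a * (ln t / t)) powr b"
      using a elim ln unfolding phi_def a_def[symmetric] b_def by simp_all
    have "\<rho> t \<le> phi d t" using elim phi by (simp add: divide_less_eq)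
    then have "\<rho> t * (ln t + 1) ^ 3 \<le> phi d t * (ln t + 1) ^ 3"
      using ln by (intro mult_right_mono) auto
    with elim(1) show ?case by (simp add: phi(2))
  qed
qed

section \<open>Superpolynomial decay\<close>

context standard_brownian_motion
begin

text \<open>With \<open>n\<close> of order \<open>L = ln t\<close>, the logarithm of the number of configurations is of order
  \<open>L + L ln L\<close>, while the exponent gained from avoidance is at least \<open>L\<close> times a power of \<open>L\<close>.\<close>

lemma wraps_prob_superpolynomial:
  fixes x\<^sub>0 :: "'n torus" and \<rho> :: "real \<Rightarrow> real"
  assumes dim: "3 \<le> CARD('n)" and pos: "\<And>t. t > 1 \<Longrightarrow> \<rho> t > 0"
    and upper: "((\<lambda>t. \<rho> t / phi CARD('n) t) \<longlongrightarrow> 0) at_top"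
    and lower: "filterlim (\<lambda>t. ln t powr (1 / real CARD('n)) * \<rho> t / phi CARD('n) t) at_top at_top"
  shows "eventually (\<lambda>t. prob {\<omega>\<in>space M. wraps (\<lambda>s. torus_shift x\<^sub>0 (B s \<omega>)) t (\<rho> t)}
    \<le> exp (- (K * ln t))) at_top"
proof -
  define d where "d = CARD('n)"
  have d3: "3 \<le> d" using dim by (simp add: d_def)
  then have d0: "0 < real d" by simp
  define h where "h = hit_const d * (1 / (4 * real d)) ^ (d - 2) / 4"
  have h: "0 < h" using hit_const_pos[of d] d0 by (simp add: h_def)
  have "filterlim (\<lambda>t. ln t powr (2 / real d) - (K + 2 * real d + 2 * real d * ln (18 * real d * (ln t + 1) ^ 3 + 1))) at_top at_top"
  proof -
    have "0 < 2 / real d" using d0 by simp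
    then show ?thesis using d0 by real_asymp
  qed
  then have "eventually (\<lambda>t. 0 \<le> ln t powr (2 / real d) - (K + 2 * real d + 2 * real d * ln (18 * real d * (ln t + 1) ^ 3 + 1))) at_top"
    by (rule filterlim_at_top[THEN iffD1, rule_format])
  \<comment> \<open>The constant \<open>1\<close> yields \<open>1 / \<rho> t \<le> t\<close> and hence the count of base points; the constant
     \<open>1 / h\<close> absorbs all constants in the exponent gained from avoidance.\<close>
  moreover have "eventually (\<lambda>t. max 1 (1 / h) * ln t powr (2 / real d) \<le> t * \<rho> t ^ (d - 2)) at_top"
    by (rule radius_power_eventually_ge[OF d3 lower[folded d_def]])
  moreover have "eventually (\<lambda>t. \<rho> t * (ln t + 1) ^ 3 \<le> 1 / 16) at_top"
    by (rule radius_eventually_small[OF d3 upper[folded d_def]]) simp_all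
  moreover have "eventually (\<lambda>t. max (exp 1) (4 * real d + 1) \<le> t) at_top"
    by (rule eventually_ge_at_top)
  ultimately show ?thesis
  proof eventually_elim
    case (elim t)
    define L where "L = ln t"
    define n where "n = nat \<lceil>L\<rceil>"
    define r where "r = \<rho> t / (4 * real d)"
    define b where "b = nat \<lfloor>t / 2\<rfloor>"
    have t: "exp 1 \<le> t" "4 * real d + 1 \<le> t" using elim(4) by auto
    have t4: "4 \<le> t" using t d3 by linarith
    have L1: "1 \<le> L" using t t4 by (simp add: L_def ln_ge_iff)
    have tL: "t = exp L" using t4 by (simp add: L_def)
    have \<rho>: "0 < \<rho> t" using pos t4 by simp
    have r0: "0 < r" using \<rho> d0 by (simp add: r_def)
    have n: "1 \<le> n" "L \<le> real n" "real n \<le> L + 1" using L1 unfolding n_def by linarith+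
    have small3: "\<rho> t * (L + 1) ^ 3 \<le> 1 / 16" using elim(3) by (simp add: L_def)
    have "\<rho> t * real n ^ 3 \<le> \<rho> t * (L + 1) ^ 3"
      using n \<rho> by (intro mult_left_mono power_mono) auto
    with small3 have "16 * (\<rho> t * real n ^ 3) \<le> 1" by linarith
    moreover have "64 * real d * real n ^ 3 * r = 16 * (\<rho> t * real n ^ 3)"
      using d0 by (simp add: r_def)
    ultimately have small: "64 * real d * real n ^ 3 * r \<le> 1" by (simp only:)
    have "\<rho> t * 1 \<le> \<rho> t * (L + 1) ^ 3"
      using \<rho> L1 by (intro mult_left_mono one_le_power) auto
    with small3 have \<rho>1: "\<rho> t \<le> 1" by linarith
    have Lp: "1 \<le> L powr (2 / real d)" using L1 d0 by (simp add: ge_one_powr_ge_zero)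
    have tr: "1 \<le> t * \<rho> t ^ (d - 2)" "1 / h * L powr (2 / real d) \<le> t * \<rho> t ^ (d - 2)"
    proof -
      have *: "max 1 (1 / h) * L powr (2 / real d) \<le> t * \<rho> t ^ (d - 2)"
        using elim(2) by (simp add: L_def)
      have "1 * 1 \<le> max 1 (1 / h) * L powr (2 / real d)" using Lp by (intro mult_mono) auto
      with * show "1 \<le> t * \<rho> t ^ (d - 2)" by linarith
      have "1 / h * L powr (2 / real d) \<le> max 1 (1 / h) * L powr (2 / real d)"
        by (intro mult_right_mono) auto
      with * show "1 / h * L powr (2 / real d) \<le> t * \<rho> t ^ (d - 2)" by linarith
    qed
    have grid: "(1 / r + 1) ^ d \<le> exp (2 * real d * L)"
    proof -
      have "\<rho> t ^ (d - 2) \<le> \<rho> t ^ 1" using \<rho> \<rho>1 d3 by (intro power_decreasing) auto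
      then have "t * \<rho> t ^ (d - 2) \<le> t * \<rho> t" using t4 by (intro mult_left_mono) auto
      then have "1 \<le> t * \<rho> t" using tr(1) by linarith
      then have "1 / \<rho> t \<le> t" using \<rho> by (simp add: divide_le_eq)
      then have "4 * real d * (1 / \<rho> t) \<le> 4 * real d * t" using d0 by (intro mult_left_mono) auto
      then have "1 / r + 1 \<le> 4 * real d * t + 1" by (simp add: r_def)
      also have "\<dots> \<le> 4 * real d * t + t" using t4 by simp
      also have "\<dots> = (4 * real d + 1) * t" by (simp add: algebra_simps)
      also have "\<dots> \<le> t * t" using t(2) t4 by (intro mult_right_mono) auto
      also have "\<dots> = exp (2 * L)" by (simp add: tL exp_add[symmetric])
      finally have "(1 / r + 1) ^ d \<le> exp (2 * L) ^ d" using r0 by (intro power_mono) auto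
      then show ?thesis by (simp add: exp_of_nat_mult[symmetric] mult_ac)
    qed
    define q where "q = ln (18 * real d * (L + 1) ^ 3 + 1)"
    have q1: "1 \<le> 18 * real d * (L + 1) ^ 3 + 1" using d0 L1 by simp
    have q0: "0 \<le> q" using q1 by (simp add: q_def)
    have shapes: "(real (18 * d * n ^ 3 + 1) ^ d) ^ n \<le> exp (2 * real d * q * L)"
    proof -
      have "18 * real d * real n ^ 3 \<le> 18 * real d * (L + 1) ^ 3"
        using n d0 by (intro mult_left_mono power_mono) auto
      then have "real (18 * d * n ^ 3 + 1) \<le> exp q" using q1 by (simp add: q_def)
      then have "(real (18 * d * n ^ 3 + 1) ^ d) ^ n \<le> (exp q ^ d) ^ n"
        by (intro power_mono) auto
      also have "\<dots> = exp (real d * q * real n)"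
        by (simp add: exp_of_nat_mult[symmetric] mult_ac)
      also have "\<dots> \<le> exp (real d * q * (2 * L))"
      proof -
        have "real n \<le> 2 * L" using n(3) L1 by linarith
        then have "real d * q * real n \<le> real d * q * (2 * L)"
          using q0 d0 by (intro mult_left_mono) auto
        then show ?thesis by simp
      qed
      finally show ?thesis by (simp add: mult_ac)
    qed
    have decay: "L * L powr (2 / real d) \<le> hit_const d * real n * r ^ (d - 2) * real b"
    proof -
      have "t / 4 \<le> real b" using t4 unfolding b_def by linarith
      have "L * L powr (2 / real d) = L * (h * (1 / h * L powr (2 / real d)))" using h by simp
      also have "\<dots> \<le> L * (h * (t * \<rho> t ^ (d - 2)))"
        using tr(2) h L1 by (intro mult_left_mono) auto
      also have "\<dots> = hit_const d * L * r ^ (d - 2) * (t / 4)"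
        by (simp add: h_def r_def power_divide power_mult_distrib)
      also have "\<dots> \<le> hit_const d * real n * r ^ (d - 2) * real b"
        using n(2) \<open>t / 4 \<le> real b\<close> hit_const_pos[of d] r0 L1 t4
        by (intro mult_mono) (auto intro!: mult_nonneg_nonneg)
      finally show ?thesis .
    qed
    have "prob {\<omega>\<in>space M. wraps (\<lambda>s. torus_shift x\<^sub>0 (B s \<omega>)) t (\<rho> t)}
      \<le> (1 / r + 1) ^ d * (real (18 * d * n ^ 3 + 1) ^ d) ^ n
         * exp (- (hit_const d * real n * r ^ (d - 2) * real b))"
      unfolding d_def b_def
      by (rule wraps_prob_le[OF dim \<rho> r_def[unfolded d_def] n(1) small[unfolded d_def]]) (use t4 in simp)
    also have "\<dots> \<le> exp (2 * real d * L) * exp (2 * real d * q * L) * exp (- (L * L powr (2 / real d)))"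
    proof (rule mult_mono)
      show "(1 / r + 1) ^ d * (real (18 * d * n ^ 3 + 1) ^ d) ^ n \<le> exp (2 * real d * L) * exp (2 * real d * q * L)"
        by (rule mult_mono[OF grid shapes]) simp_all
      show "exp (- (hit_const d * real n * r ^ (d - 2) * real b)) \<le> exp (- (L * L powr (2 / real d)))"
        using decay by simp
    qed simp_all
    also have "\<dots> = exp (L * (2 * real d + 2 * real d * q - L powr (2 / real d)))"
      by (simp add: exp_add[symmetric] algebra_simps)
    also have "\<dots> \<le> exp (L * (- K))"
    proof -
      have "2 * real d + 2 * real d * q - L powr (2 / real d) \<le> - K"
        using elim(1) by (simp add: q_def L_def)
      then have "L * (2 * real d + 2 * real d * q - L powr (2 / real d)) \<le> L * (- K)"
        using L1 by (intro mult_left_mono) auto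
      then show ?thesis by simp
    qed
    finally show ?case by (simp add: L_def mult.commute)
  qed
qed

end

theorem proposition1p10:
  fixes M :: "'a measure"
    and B :: "real \<Rightarrow> 'a \<Rightarrow> real ^ 'n::finite"
    and x\<^sub>0 :: "'n torus"
    and \<rho> :: "real \<Rightarrow> real"
  assumes dim: "CARD('n) \<ge> 3"
    and BM: "standard_brownian_motion M B"
    and rho_pos: "\<And>t. t > 1 \<Longrightarrow> \<rho> t > 0"
    and rho_upper: "((\<lambda>t. \<rho> t / phi CARD('n) t) \<longlongrightarrow> 0) at_top"
    and rho_lower:
      "filterlim (\<lambda>t. ln t powr (1 / real CARD('n)) * \<rho> t / phi CARD('n) t) at_top at_top"
  shows "((\<lambda>t. ereal_log (measure M {\<omega> \<in> space M. wraps (\<lambda>s. torus_shift x\<^sub>0 (B s \<omega>)) t (\<rho> t)})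
             / ereal (ln t)) \<longlongrightarrow> -\<infinity>) at_top"
  unfolding tendsto_MInfty
proof
  fix a :: real
  interpret standard_brownian_motion M B by (rule BM)
  have "eventually (\<lambda>t. prob {\<omega>\<in>space M. wraps (\<lambda>s. torus_shift x\<^sub>0 (B s \<omega>)) t (\<rho> t)}
      \<le> exp (- ((1 - a) * ln t))) at_top"
    using dim rho_pos rho_upper rho_lower by (rule wraps_prob_superpolynomial)
  moreover have "eventually (\<lambda>t :: real. 1 < t) at_top" by (rule eventually_gt_at_top)
  ultimately show "eventually (\<lambda>t. ereal_log (measure M {\<omega> \<in> space M. wraps (\<lambda>s. torus_shift x\<^sub>0 (B s \<omega>)) t (\<rho> t)})
             / ereal (ln t) < ereal a) at_top"
  proof eventually_elim
    case (elim t)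
    let ?p = "measure M {\<omega> \<in> space M. wraps (\<lambda>s. torus_shift x\<^sub>0 (B s \<omega>)) t (\<rho> t)}"
    have ln: "0 < ln t" using elim(2) by simp
    show ?case
    proof (cases "?p = 0")
      case True
      then show ?thesis using ln by (simp add: ereal_log_def)
    next
      case False
      then have p: "0 < ?p" by (simp add: zero_less_measure_iff)
      have "ln ?p \<le> ln (exp (- ((1 - a) * ln t)))" using elim(1) p by (simp only: ln_le_cancel_iff exp_gt_zero)
      also have "\<dots> = (a - 1) * ln t" by (simp add: algebra_simps)
      finally have "ln ?p / ln t \<le> a - 1" using ln by (simp only: pos_divide_le_eq)
      then show ?thesis using False ln by (simp add: ereal_log_def)
    qed
  qed
qed

end
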